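(* Let $d\ge 1$, let $w\in\mathbb{R}^d$, and let $X(t)=wt$, $t\ge 0$, be the solution of $\mathrm{d}X(t)=w\,\mathrm{d}t$, $X(0)=0$. Let $\alpha>0$, $f(x)=e^{-\alpha|x|}$ for $x\in\mathbb{R}^d$, and let $u(t)=f(X(t))=e^{-\alpha t|w|}$, $t\ge0$, be the corresponding solution of the Liouville equation. Let $S$ be a subordinator with Laplace exponent $\Phi$, Lévy measure $\sigma$, kernel $k$ and Laplace transform of the kernel $\mathcal{K}$, let $E$ be the inverse of $S$, and let $G_t$ be the density of $E(t)$. Assume that: (1) $\Phi$ is a complete Bernstein function, that is, the Lévy measure $\sigma$ is absolutely continuous with respect to the Lebesgue measure, and $\mathcal{K}(\lambda)\to\infty$, $\Phi(\lambda)\to 0$ as $\lambda\to0$, and $\mathcal{K}(\lambda)\to0$, $\Phi(\lambda)\to\infty$ as $\lambda\to\infty$; (2) $\mathcal{K}(\lambda)\sim\lambda^{-\gamma}Q(1/\lambda)$ as $\lambda\to0$, where $0\le\gamma\le 1$ and $Q$ is a slowly varying function. Define the subordinated function $$v(t):=\mathbb{E}[f(X(E(t)))]=\int_0^\infty u(\tau)\,G_t(\tau)\,\mathrm{d}\tau,\qquad t>0.$$ Then $$v(t)\sim\frac{1}{\alpha|w|\,\Gamma(\gamma)}\,t^{\gamma-1}Q(t),\qquad t\to\infty.$$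
   Context: A subordinator is a process $S=\{S(t),t\ge0\}$ with $S(0)=0$, stationary independent increments, and almost surely increasing right-continuous paths with left limits. Its Laplace transform is $\mathbb{E}[e^{-\lambda S(t)}]=e^{-t\Phi(\lambda)}$, $\lambda\ge0$, with Laplace exponent (Bernstein function) $\Phi(\lambda)=\int_0^\infty(1-e^{-\lambda\tau})\,\mathrm{d}\sigma(\tau)$, where the Lévy measure $\sigma$, supported in $[0,\infty)$, satisfies $\int_0^\infty(1\wedge\tau)\,\mathrm{d}\sigma(\tau)<\infty$. The kernel is $k(t):=\sigma((t,\infty))$, $t>0$, and $\mathcal{K}(\lambda):=\int_0^\infty e^{-\lambda t}k(t)\,\mathrm{d}t$, so that $\Phi(\lambda)=\lambda\mathcal{K}(\lambda)$. The inverse of $S$ is $E(t):=\inf\{r>0: S(r)>t\}$, $t\ge0$, and $G_t(\tau)$, $\tau\ge0$, denotes the marginal density of $E(t)$. $f\sim g$ means that $f/g\to1$ in the indicated limit. A function $Q$ is slowly varying if $\lim_{x\to+\infty}Q(\lambda x)/Q(x)=1$ for every $\lambda>0$. $\Gamma$ is the gamma function. The formula in the conclusion presupposes $w\ne0$.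
   Formalization: For γ = 0 the constant 1/Γ(γ) is undefined (Γ has a pole at 0), so in that case the conclusion is read as v(t) = o(t^{γ-1}Q(t)) as t→∞; for 0 < γ ≤ 1 the conclusion is exactly as stated. *)

theory Defs
  imports "HOL-Probability.Probability"
begin

locale subordinator = prob_space M for M :: "'a measure" +
  fixes S :: "real \<Rightarrow> 'a \<Rightarrow> real"
  assumes random_variable_S: "\<And>t. 0 \<le> t \<Longrightarrow> random_variable borel (S t)"
    and start_zero: "AE \<omega> in M. S 0 \<omega> = 0"
    and stationary_increments:
      "\<And>s h. 0 \<le> s \<Longrightarrow> 0 \<le> h \<Longrightarrow>
        distr M borel (\<lambda>\<omega>. S (s + h) \<omega> - S s \<omega>) = distr M borel (\<lambda>\<omega>. S h \<omega> - S 0 \<omega>)"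
    and independent_increments:
      "\<And>(ts :: nat \<Rightarrow> real) n. 0 \<le> ts 0 \<Longrightarrow> (\<And>i. i < n \<Longrightarrow> ts i \<le> ts (Suc i)) \<Longrightarrow>
        indep_vars (\<lambda>_. borel) (\<lambda>i \<omega>. S (ts (Suc i)) \<omega> - S (ts i) \<omega>) {..<n}"
    and increasing_paths: "AE \<omega> in M. mono_on {0..} (\<lambda>t. S t \<omega>)"
    and cadlag_paths:
      "AE \<omega> in M. (\<forall>t\<ge>0. ((\<lambda>s. S s \<omega>) \<longlongrightarrow> S t \<omega>) (at_right t)) \<and>
                  (\<forall>t>0. \<exists>l. ((\<lambda>s. S s \<omega>) \<longlongrightarrow> l) (at_left t))"

definition levy_measure :: "real measure \<Rightarrow> bool" where
  "levy_measure \<sigma> \<longleftrightarrow>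
     sets \<sigma> = sets borel \<and> emeasure \<sigma> {..<0} = 0 \<and>
     (\<integral>\<^sup>+ \<tau>\<in>{0..}. ennreal (min 1 \<tau>) \<partial>\<sigma>) < \<infinity>"

definition laplace_exponent :: "real measure \<Rightarrow> real \<Rightarrow> real" where
  "laplace_exponent \<sigma> l = (LINT \<tau>:{0..}|\<sigma>. 1 - exp (- l * \<tau>))"

text \<open>Only meaningful for \<open>t > 0\<close>, where the tail of a Levy measure is finite.\<close>

definition levy_kernel :: "real measure \<Rightarrow> real \<Rightarrow> real" where
  "levy_kernel \<sigma> t = measure \<sigma> {t<..}"

definition kernel_laplace :: "real measure \<Rightarrow> real \<Rightarrow> real" where
  "kernel_laplace \<sigma> l = (LINT t:{0<..}|lborel. exp (- l * t) * levy_kernel \<sigma> t)"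

definition has_levy_measure :: "'a measure \<Rightarrow> (real \<Rightarrow> 'a \<Rightarrow> real) \<Rightarrow> real measure \<Rightarrow> bool" where
  "has_levy_measure M S \<sigma> \<longleftrightarrow> levy_measure \<sigma> \<and>
     (\<forall>l\<ge>0. \<forall>t\<ge>0. (\<integral>\<omega>. exp (- l * S t \<omega>) \<partial>M) = exp (- t * laplace_exponent \<sigma> l))"

text \<open>On a path bounded by \<open>t\<close> this is the unspecified value \<open>Inf {}\<close>; for a
  subordinator whose Laplace exponent is not identically zero such paths form a null set.\<close>

definition inverse_process :: "(real \<Rightarrow> 'a \<Rightarrow> real) \<Rightarrow> real \<Rightarrow> 'a \<Rightarrow> real" where
  "inverse_process S t \<omega> = Inf {r. 0 < r \<and> t < S r \<omega>}"

text \<open>The indicator makes the values of \<open>g\<close> on the negative half-line irrelevant.\<close>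

definition nonneg_density :: "'a measure \<Rightarrow> ('a \<Rightarrow> real) \<Rightarrow> (real \<Rightarrow> real) \<Rightarrow> bool" where
  "nonneg_density M Y g \<longleftrightarrow> (\<forall>\<tau>\<ge>0. 0 \<le> g \<tau>) \<and>
     distributed M lborel Y (\<lambda>\<tau>. ennreal (indicator {0..} \<tau> * g \<tau>))"

definition slowly_varying :: "(real \<Rightarrow> real) \<Rightarrow> bool" where
  "slowly_varying Q \<longleftrightarrow> (\<forall>c>0. ((\<lambda>x. Q (c * x) / Q x) \<longlongrightarrow> 1) at_top)"

end

theory Submission
  imports Defs "HOL-Real_Asymp.Real_Asymp"
begin

text \<open>
  Put \<open>a = \<alpha> |w|\<close>. Almost surely \<open>E(t) \<le> r\<close> and \<open>S(r) > t\<close> are the same event, because \<open>E(t)\<close>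
  has no atoms, so \<open>v(t) = \<integral> a e\<^sup>-\<^sup>a\<^sup>r P(S(r) > t) dr\<close>; taking Laplace transforms in \<open>t\<close> turns this
  into \<open>\<Phi>(l) / (l (a + \<Phi>(l))) = K(l) / (a + \<Phi>(l))\<close>, which is asymptotic to \<open>K(l) / a\<close> at \<open>0\<close>.
  Since \<open>v\<close> is nonincreasing, a Tauberian theorem of Karamata type finishes the proof. That theorem
  follows from the method of moments on \<open>[0,1]\<close>: under \<open>x = e\<^sup>-\<^sup>l\<^sup>s\<close> the measure
  \<open>e\<^sup>-\<^sup>l\<^sup>s v(s) ds / L(l)\<close> has moments \<open>L((n + 1) l) / L(l)\<close>, and test functions supported just
  below and just above \<open>x = e\<^sup>-\<^sup>1\<close>, that is \<open>s = 1 / l\<close>, bracket \<open>v(1 / l)\<close> by monotonicity.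
\<close>

subsection \<open>The Tauberian theorem for monotone functions\<close>

text \<open>Approximating indicator functions would require care at the ends of the intervals.
  Continuous bumps avoid this: they vanish at x = 1, where the limit law concentrates when \<gamma>
  = 0, and monotonicity of v replaces the sharp cut-off. What the bracketing loses is the gap
  between the values of s^(\<gamma>-1) at the two ends of the support. Since \<gamma> \<le> 1 this
  power is nonincreasing, so those two values bound all others, and the gap closes as the support
  shrinks to s = 1. The resulting constant is 1/\<Gamma>(\<gamma>), written
  \<open>rGamma \<gamma>\<close>; it is 0 at \<gamma> = 0, where the asymptotic formula turns into a
  little-o statement.

  On the probabilistic side the obstacle is measurability in time: E(t) is given as a random
  variable for each t separately. The computation therefore runs through the function (r, t) ->
  P(S(r) > t), which is jointly measurable because it is monotone in r and right-continuous in t.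
  All interchanges are made for nonnegative extended integrals, so Tonelli applies before any
  integrability is known.\<close>

lemma (in prob_space) integrable_continuous_unit_interval:
  fixes k :: "real \<Rightarrow> real"
  assumes X [measurable]: "random_variable borel X" and unit: "AE x in M. X x \<in> {0..1}"
    and k: "continuous_on UNIV k"
  shows "integrable M (\<lambda>x. k (X x))"
proof -
  have [measurable]: "k \<in> borel_measurable borel"
    using k by (rule borel_measurable_continuous_onI)
  have "bounded (k ` {0..1})"
    by (intro compact_imp_bounded compact_continuous_image continuous_on_subset[OF k]) auto
  then obtain B where B: "\<And>x. x \<in> {0..1} \<Longrightarrow> norm (k x) \<le> B"
    unfolding bounded_iff by blast
  have "AE x in M. norm (k (X x)) \<le> B"
    using unit by eventually_elim (rule B)
  then show ?thesis
    by (rule integrable_const_bound) measurable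
qed

lemma (in prob_space) expectation_continuous_unit_interval_close:
  fixes h g :: "real \<Rightarrow> real"
  assumes X: "random_variable borel X" and unit: "AE x in M. X x \<in> {0..1}"
    and h: "continuous_on UNIV h" and g: "continuous_on UNIV g"
    and close: "\<And>x. x \<in> {0..1} \<Longrightarrow> \<bar>h x - g x\<bar> \<le> e"
  shows "\<bar>expectation (\<lambda>x. h (X x)) - expectation (\<lambda>x. g (X x))\<bar> \<le> e"
proof -
  note int = integrable_continuous_unit_interval[OF X unit]
  have "\<bar>expectation (\<lambda>x. h (X x)) - expectation (\<lambda>x. g (X x))\<bar>
      = \<bar>expectation (\<lambda>x. h (X x) - g (X x))\<bar>"
    using int[OF h] int[OF g] by simp
  also have "\<dots> \<le> expectation (\<lambda>x. \<bar>h (X x) - g (X x)\<bar>)"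
    by (rule integral_abs_bound)
  also have "\<dots> \<le> expectation (\<lambda>x. e)"
  proof (rule integral_mono_AE)
    show "AE x in M. \<bar>h (X x) - g (X x)\<bar> \<le> e"
      using unit by eventually_elim (rule close)
  qed (use int[OF h] int[OF g] in auto)
  also have "\<dots> = e"
    by (simp add: prob_space)
  finally show ?thesis .
qed

text \<open>By Weierstrass, \<open>h\<close> is within e/3 of a polynomial uniformly on [0,1]. All
  laws are probability measures on [0,1], so the exchange costs at most e/3 on either side,
  uniformly in \<open>i\<close>, and the expectation of the polynomial is a finite combination of
  moments. As the limit law is given, no compactness argument is involved.\<close>

lemma moments_tendsto_imp_expectation_tendsto:
  fixes N :: "'i \<Rightarrow> 'a measure" and X :: "'i \<Rightarrow> 'a \<Rightarrow> real"
    and N0 :: "'b measure" and X0 :: "'b \<Rightarrow> real" and h :: "real \<Rightarrow> real"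
  assumes N: "\<forall>\<^sub>F i in F. prob_space (N i) \<and> X i \<in> borel_measurable (N i) \<and>
      (AE x in N i. X i x \<in> {0..1})"
    and N0: "prob_space N0" "X0 \<in> borel_measurable N0" "AE x in N0. X0 x \<in> {0..1}"
    and moments: "\<And>n. ((\<lambda>i. \<integral>x. X i x ^ n \<partial>N i) \<longlongrightarrow> (\<integral>x. X0 x ^ n \<partial>N0)) F"
    and h: "continuous_on UNIV h"
  shows "((\<lambda>i. \<integral>x. h (X i x) \<partial>N i) \<longlongrightarrow> (\<integral>x. h (X0 x) \<partial>N0)) F"
proof (rule tendstoI)
  fix e :: real assume e: "0 < e"
  obtain g where g: "real_polynomial_function g"
      and hg: "\<And>x. x \<in> {0..1} \<Longrightarrow> \<bar>h x - g x\<bar> < e / 3"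
    using Stone_Weierstrass_real_polynomial_function[of "{0..1::real}" h "e / 3"]
      continuous_on_subset[OF h] e by auto
  obtain a n where gsum: "g = (\<lambda>x. \<Sum>i\<le>n. a i * x ^ i)"
    using g unfolding real_polynomial_function_iff_sum by blast
  have g_cont: "continuous_on UNIV g"
    unfolding gsum by (intro continuous_intros)
  \<comment> \<open>Stated for a type of its own, because it is applied both to \<open>N i\<close>
    and to \<open>N0\<close>, which live on different spaces.\<close>
  have int_g: "(\<integral>x. g (Y x) \<partial>P) = (\<Sum>i\<le>n. a i * (\<integral>x. Y x ^ i \<partial>P))"
    if P: "prob_space P" and Y: "Y \<in> borel_measurable P"
      and unit: "AE x in P. Y x \<in> {0..1}" for P :: "'c measure" and Y
  proof -
    interpret prob_space P by fact
    have "integrable P (\<lambda>x. Y x ^ i)" for i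
      by (intro integrable_continuous_unit_interval[OF Y unit] continuous_intros)
    then show ?thesis
      unfolding gsum by simp
  qed
  have int_g0: "(\<integral>x. g (X0 x) \<partial>N0) = (\<Sum>i\<le>n. a i * (\<integral>x. X0 x ^ i \<partial>N0))"
    using int_g N0 by blast
  have "((\<lambda>i. \<Sum>k\<le>n. a k * (\<integral>x. X i x ^ k \<partial>N i)) \<longlongrightarrow> (\<Sum>k\<le>n. a k * (\<integral>x. X0 x ^ k \<partial>N0))) F"
    by (intro tendsto_intros moments)
  then have "\<forall>\<^sub>F i in F. dist (\<Sum>k\<le>n. a k * (\<integral>x. X i x ^ k \<partial>N i))
      (\<Sum>k\<le>n. a k * (\<integral>x. X0 x ^ k \<partial>N0)) < e / 3"
    by (rule tendstoD) (use e in simp)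
  then show "\<forall>\<^sub>F i in F. dist (\<integral>x. h (X i x) \<partial>N i) (\<integral>x. h (X0 x) \<partial>N0) < e"
    using N
  proof eventually_elim
    case (elim i)
    have "\<bar>(\<integral>x. h (X i x) \<partial>N i) - (\<integral>x. g (X i x) \<partial>N i)\<bar> \<le> e / 3"
      by (intro prob_space.expectation_continuous_unit_interval_close h g_cont)
        (use elim hg in \<open>auto intro: less_imp_le\<close>)
    moreover have "\<bar>(\<integral>x. h (X0 x) \<partial>N0) - (\<integral>x. g (X0 x) \<partial>N0)\<bar> \<le> e / 3"
      by (intro prob_space.expectation_continuous_unit_interval_close h g_cont N0)
        (use hg in \<open>auto intro: less_imp_le\<close>)
    ultimately show ?case
      using elim int_g[of "N i" "X i"] unfolding int_g0 dist_real_def by linarith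
  qed
qed

section \<open>The Gamma limit law and its test functions\<close>

lemma Gamma_density_laplace:
  fixes \<gamma> c :: real
  assumes "0 < \<gamma>" "0 < c"
  shows "(\<integral>\<^sup>+s. ennreal (indicator {0<..} s * (s powr (\<gamma> - 1) * exp (- c * s))) \<partial>lborel)
    = ennreal (Gamma \<gamma> * c powr (- \<gamma>))"
proof -
  let ?f = "\<lambda>t. ennreal (indicator {0..} t * t powr (\<gamma> - 1) / exp t)"
  have [measurable]: "?f \<in> borel_measurable borel" by measurable
  \<comment> \<open>Euler's integral after the substitution s -> c s; the Jacobian \<open>c\<close>
    and the factor \<open>c powr (\<gamma> - 1)\<close> combine to
    \<open>c powr \<gamma>\<close>.\<close>
  have "ennreal (Gamma \<gamma>) = ennreal \<bar>c\<bar> * (\<integral>\<^sup>+s. ?f (0 + c * s) \<partial>lborel)"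
    unfolding Gamma_conv_nn_integral_real[OF assms(1)]
    by (rule nn_integral_real_affine) (use assms in auto)
  also have "(\<integral>\<^sup>+s. ?f (0 + c * s) \<partial>lborel) = (\<integral>\<^sup>+s. ennreal (c powr (\<gamma> - 1)) *
      ennreal (indicator {0<..} s * (s powr (\<gamma> - 1) * exp (- c * s))) \<partial>lborel)"
    using AE_lborel_singleton[of 0]
    by (intro nn_integral_cong_AE)
      (use assms in \<open>auto simp: indicator_def zero_le_mult_iff powr_mult exp_minus field_simps
         simp flip: ennreal_mult\<close>)
  also have "\<dots> = ennreal (c powr (\<gamma> - 1)) *
      (\<integral>\<^sup>+s. ennreal (indicator {0<..} s * (s powr (\<gamma> - 1) * exp (- c * s))) \<partial>lborel)"
    by (rule nn_integral_cmult) measurable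
  finally have *: "ennreal (Gamma \<gamma>) = ennreal (c powr \<gamma>) *
      (\<integral>\<^sup>+s. ennreal (indicator {0<..} s * (s powr (\<gamma> - 1) * exp (- c * s))) \<partial>lborel)"
    using assms by (simp add: powr_diff mult.assoc[symmetric] flip: ennreal_mult)
  have "ennreal (Gamma \<gamma> * c powr (- \<gamma>)) = ennreal (c powr (- \<gamma>)) * ennreal (Gamma \<gamma>)"
    using assms by (simp add: ennreal_mult mult.commute Gamma_real_pos less_imp_le)
  also have "\<dots> = (\<integral>\<^sup>+s. ennreal (indicator {0<..} s * (s powr (\<gamma> - 1) * exp (- c * s))) \<partial>lborel)"
    unfolding * using assms
    by (simp add: mult.assoc[symmetric] flip: ennreal_mult powr_add)
  finally show ?thesis by simp
qed

text \<open>A test function in \<open>x = e\<^sup>-\<^sup>s\<close> whose support is \<open>a \<le> s \<le> b\<close>.\<close>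

definition log_bump :: "real \<Rightarrow> real \<Rightarrow> real \<Rightarrow> real" where
  "log_bump a b x = max 0 ((x - exp (- b)) * (exp (- a) - x))"

lemma continuous_on_log_bump: "continuous_on A (log_bump a b)"
  unfolding log_bump_def by (intro continuous_intros)

lemma log_bump_measurable [measurable]: "log_bump a b \<in> borel_measurable borel"
  by (rule borel_measurable_continuous_onI[OF continuous_on_log_bump])

lemma log_bump_nonneg: "0 \<le> log_bump a b x"
  by (simp add: log_bump_def)

lemma log_bump_exp_pos_iff:
  assumes "a < b"
  shows "0 < log_bump a b (exp (- s)) \<longleftrightarrow> a < s \<and> s < b"
  using assms by (auto simp: log_bump_def less_max_iff_disj zero_less_mult_iff)

lemma log_bump_exp_eq_0:
  assumes "a < b" "s \<le> a \<or> b \<le> s"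
  shows "log_bump a b (exp (- s)) = 0"
  using log_bump_exp_pos_iff[OF assms(1), of s] log_bump_nonneg[of a b "exp (- s)"] assms(2) by linarith

lemma log_bump_exp_integrable:
  assumes "a < b"
  shows "integrable lborel (\<lambda>s. exp (- s) * log_bump a b (exp (- s)))"
proof -
  have "integrable lborel (\<lambda>s. indicator {a..b} s *\<^sub>R (exp (- s) * log_bump a b (exp (- s))))"
    unfolding set_integrable_def[symmetric] log_bump_def
    by (intro borel_integrable_atLeastAtMost' continuous_intros)
  also have "(\<lambda>s. indicator {a..b} s *\<^sub>R (exp (- s) * log_bump a b (exp (- s))))
      = (\<lambda>s. exp (- s) * log_bump a b (exp (- s)))"
    using log_bump_exp_eq_0[OF assms] by (force simp: fun_eq_iff indicator_def not_le intro: less_imp_le)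
  finally show ?thesis .
qed

text \<open>Under x = e^(-s) this is the Lebesgue integral of the bump in x. Its value is never
  computed: it is a common factor of both sides of every comparison and cancels, being
  positive.\<close>

definition log_bump_mass :: "real \<Rightarrow> real \<Rightarrow> real" where
  "log_bump_mass a b = (\<integral>s. exp (- s) * log_bump a b (exp (- s)) \<partial>lborel)"

lemma log_bump_mass_pos:
  assumes "a < b"
  shows "0 < log_bump_mass a b"
proof -
  have "log_bump_mass a b \<noteq> 0"
  proof
    assume "log_bump_mass a b = 0"
    then have "AE s in lborel. exp (- s) * log_bump a b (exp (- s)) = 0"
      unfolding log_bump_mass_def
      by (subst (asm) integral_nonneg_eq_0_iff_AE)
        (auto simp: log_bump_exp_integrable[OF assms] log_bump_nonneg)
    then have "AE s in lborel. s \<notin> {a<..<b}"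
    proof eventually_elim
      case (elim s)
      then show ?case
        using log_bump_exp_pos_iff[OF assms, of s] by auto
    qed
    then have "emeasure lborel {a<..<b} = 0"
      by (subst (asm) AE_iff_measurable[of "{a<..<b}"]) auto
    then show False
      using assms by simp
  qed
  moreover have "0 \<le> log_bump_mass a b"
    unfolding log_bump_mass_def by (intro integral_nonneg_AE) (simp add: log_bump_nonneg)
  ultimately show ?thesis by simp
qed

text \<open>
  The law \<open>X\<close> is the image under \<open>e\<^sup>-\<^sup>s\<close> of the Gamma distribution of shape \<open>\<gamma>\<close>, which
  degenerates to the point mass at \<open>X = 1\<close> when \<open>\<gamma> = 0\<close>; as \<open>rGamma 0 = 0\<close>, the same bounds cover both.
\<close>

lemma regular_variation_limit_law:
  fixes \<gamma> :: real
  assumes "0 \<le> \<gamma>" "\<gamma> \<le> 1"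
  obtains N :: "real measure" and X :: "real \<Rightarrow> real"
  where "prob_space N" "X \<in> borel_measurable N" "AE x in N. X x \<in> {0..1}"
    and "\<And>n. (\<integral>x. X x ^ n \<partial>N) = (real n + 1) powr (- \<gamma>)"
    and "\<And>a b. 0 < a \<Longrightarrow> a < b \<Longrightarrow>
      rGamma \<gamma> * b powr (\<gamma> - 1) * log_bump_mass a b \<le> (\<integral>x. log_bump a b (X x) \<partial>N)"
    and "\<And>a b. 0 < a \<Longrightarrow> a < b \<Longrightarrow>
      (\<integral>x. log_bump a b (X x) \<partial>N) \<le> rGamma \<gamma> * a powr (\<gamma> - 1) * log_bump_mass a b"
proof (cases "\<gamma> = 0")
  case True
  \<comment> \<open>The point \<open>1 = exp (- 0)\<close> lies outside the support because
    \<open>0 < a\<close>. Both bounds thus read \<open>0 \<le> 0\<close>, and all moments equal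
    \<open>1\<close>.\<close>
  have "log_bump a b 1 = 0" if "0 < a" "a < b" for a b
    using log_bump_exp_eq_0[of a b 0] that by simp
  with True show ?thesis
    by (intro that[of "return borel 0" "\<lambda>_. 1"])
      (auto simp: prob_space_return measure_return)
next
  case False
  with assms have pos: "0 < \<gamma>" by simp
  define D where "D = (\<lambda>s. indicator {0<..} s * (rGamma \<gamma> * s powr (\<gamma> - 1) * exp (- s)))"
  have [measurable]: "D \<in> borel_measurable borel"
    unfolding D_def by measurable
  have rGamma: "0 < rGamma \<gamma>" "rGamma \<gamma> * Gamma \<gamma> = 1"
    using Gamma_real_pos[OF pos] unfolding rGamma_inverse_Gamma by simp_all
  then have D_nonneg: "0 \<le> D s" for s
    by (simp add: D_def)
  have moment: "has_bochner_integral lborel (\<lambda>s. D s * exp (- s) ^ n) ((real n + 1) powr (- \<gamma>))" for n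
  proof (rule has_bochner_integral_nn_integral)
    have "D s * exp (- s) ^ n = rGamma \<gamma> *
        (indicator {0<..} s * (s powr (\<gamma> - 1) * exp (- (real n + 1) * s)))" for s
      by (simp add: D_def field_simps exp_of_nat_mult[symmetric] exp_add[symmetric] exp_minus)
    then have "(\<integral>\<^sup>+s. ennreal (D s * exp (- s) ^ n) \<partial>lborel) = ennreal (rGamma \<gamma>) *
        (\<integral>\<^sup>+s. ennreal (indicator {0<..} s * (s powr (\<gamma> - 1) * exp (- (real n + 1) * s))) \<partial>lborel)"
      using rGamma(1) by (subst nn_integral_cmult[symmetric]) (auto simp: ennreal_mult)
    also have "\<dots> = ennreal (rGamma \<gamma>) * ennreal (Gamma \<gamma> * (real n + 1) powr (- \<gamma>))"
      by (subst Gamma_density_laplace) (use pos in auto)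
    also have "\<dots> = ennreal ((real n + 1) powr (- \<gamma>))"
      using rGamma Gamma_real_pos[OF pos]
      by (simp add: mult.assoc[symmetric] flip: ennreal_mult)
    finally show "(\<integral>\<^sup>+s. ennreal (D s * exp (- s) ^ n) \<partial>lborel) = ennreal ((real n + 1) powr (- \<gamma>))" .
  qed (auto simp: D_nonneg)
  define N where "N = density lborel (\<lambda>s. ennreal (D s))"
  have int_N: "(\<integral>x. g x \<partial>N) = (\<integral>x. D x * g x \<partial>lborel)"
    if [measurable]: "g \<in> borel_measurable borel" for g :: "real \<Rightarrow> real"
    unfolding N_def by (subst integral_density) (auto simp: D_nonneg)
  have prob: "prob_space N"
    using moment[of 0]
    by (intro prob_spaceI) (auto simp: N_def emeasure_density has_bochner_integral_iff
      nn_integral_eq_integral D_nonneg)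
  have unit: "AE s in N. exp (- s) \<in> {0..1}"
    unfolding N_def by (subst AE_density) (auto simp: D_def indicator_def)
  \<comment> \<open>The factor \<open>exp (- s)\<close> stays on both sides; only
    \<open>s powr (\<gamma> - 1)\<close> is compared with its values at the ends of the support,
    which is where \<open>\<gamma> \<le> 1\<close> enters.\<close>
  have bump_bounds: "rGamma \<gamma> * b powr (\<gamma> - 1) * (exp (- s) * log_bump a b (exp (- s)))
        \<le> D s * log_bump a b (exp (- s))"
      "D s * log_bump a b (exp (- s))
        \<le> rGamma \<gamma> * a powr (\<gamma> - 1) * (exp (- s) * log_bump a b (exp (- s)))"
    if "0 < a" "a < b" for a b s
  proof -
    have "b powr (\<gamma> - 1) \<le> s powr (\<gamma> - 1)" "s powr (\<gamma> - 1) \<le> a powr (\<gamma> - 1)" if "a < s" "s < b"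
      using that \<open>0 < a\<close> assms by (auto intro!: powr_mono2')
    then show "rGamma \<gamma> * b powr (\<gamma> - 1) * (exp (- s) * log_bump a b (exp (- s)))
        \<le> D s * log_bump a b (exp (- s))"
      "D s * log_bump a b (exp (- s))
        \<le> rGamma \<gamma> * a powr (\<gamma> - 1) * (exp (- s) * log_bump a b (exp (- s)))"
      using log_bump_exp_eq_0[OF \<open>a < b\<close>, of s] log_bump_nonneg[of a b "exp (- s)"] rGamma(1) \<open>0 < a\<close>
      by (cases "a < s \<and> s < b"; force simp: D_def intro!: mult_left_mono mult_right_mono)+
  qed
  have int: "integrable lborel (\<lambda>s. D s * log_bump a b (exp (- s)))" if "0 < a" "a < b" for a b
    by (rule Bochner_Integration.integrable_bound[OF
          integrable_mult_right[OF log_bump_exp_integrable[OF that(2)], of "rGamma \<gamma> * a powr (\<gamma> - 1)"]])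
      (use bump_bounds(2)[OF that] D_nonneg log_bump_nonneg rGamma in auto)
  show ?thesis
  proof (rule that[of N "\<lambda>s. exp (- s)"])
    show "(\<lambda>s. exp (- s)) \<in> borel_measurable N"
      by (simp add: N_def)
    show "(\<integral>x. exp (- x) ^ n \<partial>N) = (real n + 1) powr (- \<gamma>)" for n
      using moment[of n] by (subst int_N) (auto simp: has_bochner_integral_iff)
    fix a b :: real assume ab: "0 < a" "a < b"
    note bumps = integrable_mult_right[OF log_bump_exp_integrable[OF ab(2)]]
    show "rGamma \<gamma> * b powr (\<gamma> - 1) * log_bump_mass a b \<le> (\<integral>x. log_bump a b (exp (- x)) \<partial>N)"
      unfolding log_bump_mass_def
      by (subst int_N, measurable, subst integral_mult_right_zero[symmetric])
        (intro integral_mono bumps int bump_bounds ab)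
    show "(\<integral>x. log_bump a b (exp (- x)) \<partial>N) \<le> rGamma \<gamma> * a powr (\<gamma> - 1) * log_bump_mass a b"
      unfolding log_bump_mass_def
      by (subst int_N, measurable, subst integral_mult_right_zero[symmetric])
        (intro integral_mono bumps int bump_bounds ab)
  qed (rule prob unit)+
qed

text \<open>The model case is V(s) = s^(\<gamma>-1) with L(l) = \<Gamma>(\<gamma>) l^(-\<gamma>),
  for which the quotient is constantly 1/\<Gamma>(\<gamma>). Regular variation is phrased through
  ratios of \<open>L\<close> alone, so that no slowly varying factor has to be carried along, and
  for \<gamma> = 0 the limit \<open>0\<close> says that V(1/l) is negligible against l L(l).\<close>

lemma antimono_Tauberian:
  fixes V L :: "real \<Rightarrow> real" and \<gamma> :: real
  assumes \<gamma>: "0 \<le> \<gamma>" "\<gamma> \<le> 1"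
    and V_nonneg: "\<And>s. 0 < s \<Longrightarrow> 0 \<le> V s"
    and V_antimono: "\<And>s t. 0 < s \<Longrightarrow> s \<le> t \<Longrightarrow> V t \<le> V s"
    and laplace: "\<And>l. 0 < l \<Longrightarrow>
      has_bochner_integral lborel (\<lambda>s. indicator {0<..} s * (exp (- l * s) * V s)) (L l)"
    and L_pos: "\<And>l. 0 < l \<Longrightarrow> 0 < L l"
    and regular: "\<And>c. 0 < c \<Longrightarrow> ((\<lambda>l. L (c * l) / L l) \<longlongrightarrow> c powr (- \<gamma>)) (at_right 0)"
  shows "((\<lambda>l. V (1 / l) / (l * L l)) \<longlongrightarrow> rGamma \<gamma>) (at_right 0)"
proof -
  obtain N0 :: "real measure" and X0 where N0: "prob_space N0" "X0 \<in> borel_measurable N0"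
      "AE x in N0. X0 x \<in> {0..1}"
    and moments0: "\<And>n. (\<integral>x. X0 x ^ n \<partial>N0) = (real n + 1) powr (- \<gamma>)"
    and bump_lower: "\<And>a b. 0 < a \<Longrightarrow> a < b \<Longrightarrow>
      rGamma \<gamma> * b powr (\<gamma> - 1) * log_bump_mass a b \<le> (\<integral>x. log_bump a b (X0 x) \<partial>N0)"
    and bump_upper: "\<And>a b. 0 < a \<Longrightarrow> a < b \<Longrightarrow>
      (\<integral>x. log_bump a b (X0 x) \<partial>N0) \<le> rGamma \<gamma> * a powr (\<gamma> - 1) * log_bump_mass a b"
    using regular_variation_limit_law[OF \<gamma>] by blast
  define D where "D l s = indicator {0<..} s * (exp (- l * s) * V s) / L l" for l s
  define N where "N l = density lborel (\<lambda>s. ennreal (D l s))" for l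
  define X where "X l s = exp (- l * s)" for l s :: real
  define W where "W l = V (1 / l) / (l * L l)" for l
  have D_has: "has_bochner_integral lborel (\<lambda>s. D l s * X l s ^ n) (L ((real n + 1) * l) / L l)"
    if "0 < l" for l n
  proof -
    have "D l s * X l s ^ n
        = indicator {0<..} s * (exp (- ((real n + 1) * l) * s) * V s) / L l" for s
      by (simp add: D_def X_def exp_of_nat_mult[symmetric] exp_add[symmetric] algebra_simps)
    then show ?thesis
      using has_bochner_integral_divide_zero[OF laplace[of "(real n + 1) * l"]] that by simp
  qed
  have D_meas: "D l \<in> borel_measurable borel" if "0 < l" for l
    using D_has[OF that, of 0] by (auto simp: has_bochner_integral_iff dest: borel_measurable_integrable)
  have D_nonneg: "0 \<le> D l s" if "0 < l" for l s
    using L_pos[OF that] V_nonneg[of s] by (auto simp: D_def indicator_def)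
  have int_N: "(\<integral>x. g x \<partial>N l) = (\<integral>x. D l x * g x \<partial>lborel)"
    if "0 < l" "g \<in> borel_measurable borel" for l and g :: "real \<Rightarrow> real"
    unfolding N_def by (subst integral_density) (use that D_nonneg D_meas in auto)
  have X_meas: "X l \<in> borel_measurable borel" for l
    unfolding X_def by measurable
  have prob: "prob_space (N l)" if "0 < l" for l
    using D_has[OF that, of 0] D_meas[OF that] D_nonneg[OF that] L_pos[OF that]
    by (intro prob_spaceI) (auto simp: N_def emeasure_density has_bochner_integral_iff
      nn_integral_eq_integral)
  have unit: "AE s in N l. X l s \<in> {0..1}" if "0 < l" for l
  proof -
    have "(\<lambda>s. ennreal (D l s)) \<in> borel_measurable lborel"
      using D_meas[OF that] by simp
    from AE_density[OF this] show ?thesis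
      unfolding N_def using that by (auto simp: D_def X_def indicator_def)
  qed
  have bump_tendsto: "((\<lambda>l. \<integral>x. log_bump a b (X l x) \<partial>N l) \<longlongrightarrow> (\<integral>x. log_bump a b (X0 x) \<partial>N0)) (at_right 0)"
    for a b
  proof (rule moments_tendsto_imp_expectation_tendsto[OF _ N0 _ continuous_on_log_bump])
    show "\<forall>\<^sub>F l in at_right 0. prob_space (N l) \<and> X l \<in> borel_measurable (N l) \<and>
        (AE x in N l. X l x \<in> {0..1})"
      by (rule eventually_at_right_less[THEN eventually_mono])
        (use prob unit X_meas in \<open>auto simp: N_def\<close>)
    fix n :: nat
    \<comment> \<open>Regular variation at \<open>c = real n + 1\<close> is exactly the convergence
      of the n-th moment.\<close>
    have "((\<lambda>l. L ((real n + 1) * l) / L l) \<longlongrightarrow> (\<integral>x. X0 x ^ n \<partial>N0)) (at_right 0)"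
      unfolding moments0 by (intro regular) auto
    moreover have "\<forall>\<^sub>F l in at_right 0. L ((real n + 1) * l) / L l = (\<integral>x. X l x ^ n \<partial>N l)"
      by (rule eventually_at_right_less[THEN eventually_mono])
        (use D_has X_meas in \<open>auto simp: int_N has_bochner_integral_iff\<close>)
    ultimately show "((\<lambda>l. \<integral>x. X l x ^ n \<partial>N l) \<longlongrightarrow> (\<integral>x. X0 x ^ n \<partial>N0)) (at_right 0)"
      by (rule Lim_transform_eventually)
  qed
  have bump_int: "(\<integral>x. log_bump a b (X l x) \<partial>N l) = (\<integral>s. D l s * log_bump a b (X l s) \<partial>lborel)"
    if "0 < l" for a b l
    using that X_meas by (subst int_N) auto
  have bump_integrable: "integrable lborel (\<lambda>s. D l s * log_bump a b (X l s))"
    if "0 < l" "0 < a" "a < b" for a b l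
  proof -
    have "integrable (N l) (\<lambda>s. log_bump a b (X l s))"
      by (intro prob_space.integrable_continuous_unit_interval prob unit that continuous_on_log_bump)
        (use X_meas in \<open>simp add: N_def\<close>)
    then show ?thesis
      unfolding N_def using D_meas D_nonneg that X_meas by (subst (asm) integrable_density) auto
  qed
  \<comment> \<open>The substitution s -> l s produces the factor 1/l, the origin of the
    \<open>l\<close> in \<open>l * L l\<close>.\<close>
  have scaled: "has_bochner_integral lborel (\<lambda>s. X l s * log_bump a b (X l s)) (log_bump_mass a b / l)"
    if "0 < l" "a < b" for a b l
  proof -
    have "has_bochner_integral lborel (\<lambda>s. exp (- s) * log_bump a b (exp (- s))) (log_bump_mass a b)"
      using log_bump_exp_integrable[OF that(2)] by (simp add: log_bump_mass_def has_bochner_integral_integrable)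
    then show ?thesis
      using that lborel_has_bochner_integral_real_affine_iff[of l
          "\<lambda>s. exp (- s) * log_bump a b (exp (- s))" "log_bump_mass a b" 0]
      by (simp add: X_def divide_inverse_commute)
  qed
  \<comment> \<open>A bump to the left of 1/l: on its support s < 1/l, so V(s) \<ge> V(1/l), and its
    expectation bounds \<open>W l\<close> from above.\<close>
  have above: "W l * log_bump_mass a 1 \<le> (\<integral>x. log_bump a 1 (X l x) \<partial>N l)"
    if "0 < l" "0 < a" "a < 1" for a l
  proof -
    have pointwise: "V (1 / l) / L l * (X l s * log_bump a 1 (X l s)) \<le> D l s * log_bump a 1 (X l s)" for s
    proof (cases "a < l * s \<and> l * s < 1")
      case True
      then have s: "0 < s"
        using that by (metis less_trans zero_less_mult_pos)
      with True that have "V (1 / l) \<le> V s"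
        by (intro V_antimono) (auto simp: field_simps)
      then show ?thesis
        using s L_pos[OF that(1)] log_bump_nonneg[of a 1 "X l s"]
        by (auto simp: D_def X_def field_simps intro!: mult_left_mono mult_right_mono)
    next
      case False
      then have "log_bump a 1 (X l s) = 0"
        using log_bump_exp_eq_0[of a 1 "l * s"] that by (auto simp: X_def)
      then show ?thesis by simp
    qed
    have "W l * log_bump_mass a 1 = V (1 / l) / L l * (log_bump_mass a 1 / l)"
      by (simp add: W_def)
    also have "\<dots> = (\<integral>s. V (1 / l) / L l * (X l s * log_bump a 1 (X l s)) \<partial>lborel)"
      using scaled[OF that(1,3)] by (simp add: has_bochner_integral_iff)
    also have "\<dots> \<le> (\<integral>s. D l s * log_bump a 1 (X l s) \<partial>lborel)"
      using scaled[OF that(1,3)] bump_integrable[OF that(1-3)]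
      by (intro integral_mono pointwise) (auto simp: has_bochner_integral_iff)
    finally show ?thesis
      using bump_int that by simp
  qed
  \<comment> \<open>The mirror image, with a bump to the right of 1/l, where V(s) \<le>
    V(1/l).\<close>
  have below: "(\<integral>x. log_bump 1 b (X l x) \<partial>N l) \<le> W l * log_bump_mass 1 b"
    if "0 < l" "1 < b" for b l
  proof -
    have pointwise: "D l s * log_bump 1 b (X l s) \<le> V (1 / l) / L l * (X l s * log_bump 1 b (X l s))" for s
    proof (cases "1 < l * s \<and> l * s < b")
      case True
      then have s: "0 < s"
        using that by (metis less_trans zero_less_mult_pos zero_less_one)
      with True that have "V s \<le> V (1 / l)"
        by (intro V_antimono) (auto simp: field_simps)
      then show ?thesis
        using s L_pos[OF that(1)] log_bump_nonneg[of 1 b "X l s"]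
        by (auto simp: D_def X_def field_simps intro!: mult_left_mono mult_right_mono)
    next
      case False
      then have "log_bump 1 b (X l s) = 0"
        using log_bump_exp_eq_0[of 1 b "l * s"] that by (auto simp: X_def)
      then show ?thesis by simp
    qed
    have "(\<integral>s. D l s * log_bump 1 b (X l s) \<partial>lborel)
        \<le> (\<integral>s. V (1 / l) / L l * (X l s * log_bump 1 b (X l s)) \<partial>lborel)"
      using scaled[OF that(1,2)] bump_integrable[OF that(1) zero_less_one that(2)]
      by (intro integral_mono pointwise) (auto simp: has_bochner_integral_iff)
    also have "\<dots> = V (1 / l) / L l * (log_bump_mass 1 b / l)"
      using scaled[OF that(1,2)] by (simp add: has_bochner_integral_iff)
    also have "\<dots> = W l * log_bump_mass 1 b"
      by (simp add: W_def)
    finally show ?thesis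
      using bump_int that by simp
  qed
  \<comment> \<open>The bounds of the limit law become sharp as the free endpoint tends to 1. That
    endpoint is fixed, depending on \<open>y\<close>, before \<open>l\<close> tends to
    \<open>0\<close>.\<close>
  have powr_tendsto: "((\<lambda>a. rGamma \<gamma> * a powr (\<gamma> - 1)) \<longlongrightarrow> rGamma \<gamma>) (at 1)"
    by (rule tendsto_eq_intros refl | simp)+
  have "(W \<longlongrightarrow> rGamma \<gamma>) (at_right 0)"
  proof (rule order_tendstoI)
    fix y assume "rGamma \<gamma> < y"
    have "\<forall>\<^sub>F a in at_left 1. rGamma \<gamma> * a powr (\<gamma> - 1) < y \<and> a \<in> {0<..<1}"
      using order_tendstoD(2)[OF filterlim_mono[OF powr_tendsto order_refl at_le[of "{..<1}" UNIV]] \<open>rGamma \<gamma> < y\<close>]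
        eventually_at_left_real[of 0 "1::real"] by (simp add: eventually_conj)
    then obtain a where a: "rGamma \<gamma> * a powr (\<gamma> - 1) < y" "0 < a" "a < 1"
      using eventually_happens[of _ "at_left (1::real)"] trivial_limit_at_left_real[of "1::real"] by (auto simp: greaterThanLessThan_iff)
    have "(\<integral>x. log_bump a 1 (X0 x) \<partial>N0) < y * log_bump_mass a 1"
      by (rule le_less_trans[OF bump_upper[OF a(2,3)]])
        (use a log_bump_mass_pos in \<open>simp add: mult_strict_right_mono\<close>)
    from order_tendstoD(2)[OF bump_tendsto this] eventually_at_right_less
    show "\<forall>\<^sub>F l in at_right 0. W l < y"
    proof eventually_elim
      case (elim l)
      then have "W l * log_bump_mass a 1 < y * log_bump_mass a 1"
        using above[of l a] a by linarith
      then show ?case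
        using log_bump_mass_pos[OF a(3)] by simp
    qed
  next
    fix y assume "y < rGamma \<gamma>"
    have "\<forall>\<^sub>F b in at_right 1. y < rGamma \<gamma> * b powr (\<gamma> - 1) \<and> 1 < b"
      using order_tendstoD(1)[OF filterlim_mono[OF powr_tendsto order_refl at_le[of "{1<..}" UNIV]] \<open>y < rGamma \<gamma>\<close>]
        eventually_at_right_less[of "1::real"] by (simp add: eventually_conj)
    then obtain b where b: "y < rGamma \<gamma> * b powr (\<gamma> - 1)" "1 < b"
      using eventually_happens[of _ "at_right (1::real)"] trivial_limit_at_right_real[of "1::real"] by auto
    have "y * log_bump_mass 1 b < (\<integral>x. log_bump 1 b (X0 x) \<partial>N0)"
      by (rule less_le_trans[OF _ bump_lower[OF zero_less_one b(2)]])
        (use b log_bump_mass_pos in \<open>simp add: mult_strict_right_mono\<close>)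
    from order_tendstoD(1)[OF bump_tendsto this] eventually_at_right_less
    show "\<forall>\<^sub>F l in at_right 0. y < W l"
    proof eventually_elim
      case (elim l)
      then have "y * log_bump_mass 1 b < W l * log_bump_mass 1 b"
        using below[of l b] b by linarith
      then show ?case
        using log_bump_mass_pos[OF b(2)] by simp
    qed
  qed
  then show ?thesis
    unfolding W_def .
qed

subsection \<open>Laplace transforms of tails\<close>

text \<open>Replace t by a grid point slightly to its right. For each mesh the approximant consists
  of countably many pieces, each measurable in x alone, and right-continuity makes the approximants
  converge pointwise.\<close>

lemma borel_measurable_right_continuous_pair:
  fixes f :: "'a \<Rightarrow> real \<Rightarrow> real"
  assumes meas: "\<And>t. (\<lambda>x. f x t) \<in> borel_measurable M"
    and right_cont: "\<And>x t. x \<in> space M \<Longrightarrow> (f x \<longlongrightarrow> f x t) (at_right t)"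
  shows "(\<lambda>(x, t). f x t) \<in> borel_measurable (M \<Otimes>\<^sub>M borel)"
proof (rule borel_measurable_LIMSEQ_real)
  \<comment> \<open>Adding 1 to the floor keeps the grid point strictly above t, as a limit along
    \<open>at_right t\<close> demands.\<close>
  define q where "q n t = (of_int \<lfloor>real (Suc n) * t\<rfloor> + 1) / real (Suc n)" for n t
  have q_gt: "t < q n t" for n t
  proof -
    have "t * real (Suc n) < of_int \<lfloor>real (Suc n) * t\<rfloor> + 1"
      by (simp add: mult.commute del: of_nat_Suc)
    then show ?thesis
      unfolding q_def by (subst pos_less_divide_eq) (auto simp del: of_nat_Suc)
  qed
  have q_le: "q n t \<le> t + inverse (real (Suc n))" for n t
  proof -
    have "of_int \<lfloor>real (Suc n) * t\<rfloor> \<le> real (Suc n) * t"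
      by (rule of_int_floor_le)
    then have "q n t \<le> (real (Suc n) * t + 1) / real (Suc n)"
      unfolding q_def by (intro divide_right_mono) auto
    then show ?thesis
      by (simp add: field_simps)
  qed
  have q_lim: "(\<lambda>n. q n t) \<longlonglongrightarrow> t" for t
  proof (rule tendsto_sandwich)
    show "\<forall>\<^sub>F n in sequentially. t \<le> q n t"
      using q_gt by (simp add: less_imp_le)
    show "\<forall>\<^sub>F n in sequentially. q n t \<le> t + inverse (real (Suc n))"
      using q_le by simp
    show "(\<lambda>n. t + inverse (real (Suc n))) \<longlonglongrightarrow> t"
      using tendsto_add[OF tendsto_const LIMSEQ_inverse_real_of_nat] by simp
  qed simp
  show "(\<lambda>n. case z of (x, t) \<Rightarrow> f x (q n t)) \<longlonglongrightarrow> (case z of (x, t) \<Rightarrow> f x t)"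
    if z: "z \<in> space (M \<Otimes>\<^sub>M borel)" for z
  proof -
    obtain x t where xt: "z = (x, t)" "x \<in> space M"
      using z by (auto simp: space_pair_measure)
    have "filterlim (\<lambda>n. q n t) (at_right t) sequentially"
      using q_lim q_gt by (simp add: filterlim_at less_imp_neq[THEN not_sym])
    with right_cont[OF xt(2)] have "(\<lambda>n. f x (q n t)) \<longlonglongrightarrow> f x t"
      by (rule filterlim_compose)
    then show ?thesis
      by (simp add: xt)
  qed
  show "(\<lambda>z. case z of (x, t) \<Rightarrow> f x (q n t)) \<in> borel_measurable (M \<Otimes>\<^sub>M borel)" for n
  proof -
    have "(\<lambda>z. f (fst z) ((of_int i + 1) / real (Suc n))) \<in> borel_measurable (M \<Otimes>\<^sub>M borel)" for i :: int
      by (rule measurable_compose[OF measurable_fst meas])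
    moreover have "(\<lambda>z :: 'a \<times> real. \<lfloor>real (Suc n) * snd z\<rfloor>) \<in> M \<Otimes>\<^sub>M borel \<rightarrow>\<^sub>M count_space UNIV"
      by measurable
    ultimately have "(\<lambda>z. f (fst z) ((of_int \<lfloor>real (Suc n) * snd z\<rfloor> + 1) / real (Suc n)))
        \<in> borel_measurable (M \<Otimes>\<^sub>M borel)"
      by (rule measurable_compose_countable)
    then show ?thesis
      by (simp add: q_def case_prod_unfold)
  qed
qed

section \<open>Elementary integrals of the exponential density\<close>

lemma nn_integral_exponential_density_lessThan:
  assumes "0 < l" "0 \<le> z"
  shows "(\<integral>\<^sup>+t. ennreal (exponential_density l t) * indicator {..<z} t \<partial>lborel) = ennreal (1 - exp (- l * z))"
proof -
  have "(\<integral>\<^sup>+t. ennreal (exponential_density l t) * indicator {..<z} t \<partial>lborel)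
      = (\<integral>\<^sup>+t. ennreal (l * exp (- t * l)) * indicator {0..z} t \<partial>lborel)"
    using AE_lborel_singleton[of z]
    by (intro nn_integral_cong_AE) (auto simp: exponential_density_def indicator_def)
  also have "\<dots> = ennreal (- exp (- z * l) - (- exp (- 0 * l)))"
    using assms by (intro nn_integral_FTC_Icc) (auto intro!: derivative_eq_intros)
  finally show ?thesis
    by (simp add: mult.commute)
qed

lemma nn_integral_exponential_density_atLeast:
  assumes "0 < l" "0 \<le> y"
  shows "(\<integral>\<^sup>+t. ennreal (exponential_density l t) * indicator {y..} t \<partial>lborel) = ennreal (exp (- l * y))"
proof -
  have "(\<integral>\<^sup>+t. ennreal (exponential_density l t) * indicator {y..} t \<partial>lborel)
      = (\<integral>\<^sup>+t. ennreal (l * exp (- t * l)) * indicator {y..} t \<partial>lborel)"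
    using assms by (intro nn_integral_cong) (auto simp: exponential_density_def indicator_def)
  also have "\<dots> = ennreal (0 - (- exp (- y * l)))"
  proof (rule nn_integral_FTC_atLeast)
    show "((\<lambda>t. - exp (- t * l)) \<longlongrightarrow> 0) at_top"
      using assms by real_asymp
  qed (use assms in \<open>auto intro!: derivative_eq_intros\<close>)
  finally show ?thesis
    by (simp add: mult.commute)
qed

text \<open>The last integration in the Laplace transform of v: with p = \<Phi>(l), the factor
  \<open>1 - exp (- r * p)\<close> is what remains of the tail of S(r) after integrating in
  t.\<close>

lemma nn_integral_exponential_density_times_compl_exp:
  assumes "0 < a" "0 \<le> p"
  shows "(\<integral>\<^sup>+r. ennreal (exponential_density a r) * ennreal (1 - exp (- r * p)) \<partial>lborel) = ennreal (p / (a + p))"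
proof -
  have "(\<integral>\<^sup>+r. ennreal (exponential_density a r) * ennreal (1 - exp (- r * p)) \<partial>lborel)
      = (\<integral>\<^sup>+r. ennreal (a * exp (- r * a) - a * exp (- r * (a + p))) * indicator {0..} r \<partial>lborel)"
    using assms by (intro nn_integral_cong)
      (auto simp: exponential_density_def indicator_def ennreal_mult[symmetric] algebra_simps
        exp_add[symmetric] intro!: arg_cong[of _ _ ennreal])
  also have "\<dots> = ennreal (0 - (- exp (- 0 * a) + a / (a + p) * exp (- 0 * (a + p))))"
  proof (rule nn_integral_FTC_atLeast)
    show "((\<lambda>r. - exp (- r * a) + a / (a + p) * exp (- r * (a + p))) \<longlongrightarrow> 0) at_top"
    proof -
      have "((\<lambda>r. exp (- r * c)) \<longlongrightarrow> 0) at_top" if "0 < c" for c :: real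
        using that by real_asymp
      from tendsto_add[OF tendsto_minus[OF this[of a]]
          tendsto_mult[OF tendsto_const[of "a / (a + p)"] this[of "a + p"]]]
      show ?thesis using assms by simp
    qed
    show "((\<lambda>r. - exp (- r * a) + a / (a + p) * exp (- r * (a + p))) has_real_derivative
        a * exp (- r * a) - a * exp (- r * (a + p))) (at r)" for r
    proof -
      have "((\<lambda>r. - exp (- r * a) + k * exp (- r * c)) has_real_derivative
          a * exp (- r * a) - k * c * exp (- r * c)) (at r)" for k c
        by (auto intro!: derivative_eq_intros)
      from this[of "a / (a + p)" "a + p"] show ?thesis
        using assms by simp
    qed
    show "0 \<le> a * exp (- r * a) - a * exp (- r * (a + p))" if "0 \<le> r" for r
      using assms that by (simp add: mult_left_mono)
  qed simp
  also have "0 - (- exp (- 0 * a) + a / (a + p) * exp (- 0 * (a + p))) = p / (a + p)"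
    using assms by (simp add: field_simps)
  finally show ?thesis .
qed

context sigma_finite_measure
begin

text \<open>The layer-cake formula, by Tonelli. The sets \<open>R z\<close> are the sections of one
  measurable subset of the plane, so that the cases t < Z and Y \<le> t share a proof. It is stated
  for sigma-finite measures because it serves the Levy measure, which may be infinite, as well as
  the probability space.\<close>

lemma nn_integral_emeasure_level_sets:
  fixes Z :: "'a \<Rightarrow> real" and g :: "real \<Rightarrow> ennreal" and R :: "real \<Rightarrow> real set"
  assumes g [measurable]: "g \<in> borel_measurable borel" and Z [measurable]: "Z \<in> borel_measurable M"
    and R: "{z \<in> space (borel \<Otimes>\<^sub>M borel). fst z \<in> R (snd z)} \<in> sets (borel \<Otimes>\<^sub>M borel)"
  shows "(\<lambda>t. emeasure M {x \<in> space M. t \<in> R (Z x)}) \<in> borel_measurable borel" (is ?meas)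
    and "(\<integral>\<^sup>+t. g t * emeasure M {x \<in> space M. t \<in> R (Z x)} \<partial>lborel)
      = (\<integral>\<^sup>+x. (\<integral>\<^sup>+t. g t * indicator (R (Z x)) t \<partial>lborel) \<partial>M)" (is ?eq)
proof -
  interpret pair_sigma_finite M lborel ..
  have R_pred: "Measurable.pred (borel \<Otimes>\<^sub>M borel) (\<lambda>z. fst z \<in> R (snd z))"
    using R by (simp add: pred_def)
  have ind [measurable]: "Measurable.pred (borel \<Otimes>\<^sub>M M) (\<lambda>z. fst z \<in> R (Z (snd z)))"
  proof -
    have "(\<lambda>z. (fst z, Z (snd z))) \<in> borel \<Otimes>\<^sub>M M \<rightarrow>\<^sub>M borel \<Otimes>\<^sub>M borel"
      by measurable
    from measurable_compose[OF this R_pred] show ?thesis by simp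
  qed
  have [measurable]: "Measurable.pred (M \<Otimes>\<^sub>M borel) (\<lambda>z. snd z \<in> R (Z (fst z)))"
  proof -
    have "(\<lambda>z. (snd z, Z (fst z))) \<in> M \<Otimes>\<^sub>M borel \<rightarrow>\<^sub>M borel \<Otimes>\<^sub>M borel"
      by measurable
    from measurable_compose[OF this R_pred] show ?thesis by simp
  qed
  have [measurable]: "Measurable.pred M (\<lambda>x. t \<in> R (Z x))" for t
    using measurable_compose[OF measurable_Pair1' ind, of t] by simp
  have emeasure: "emeasure M {x \<in> space M. t \<in> R (Z x)} = (\<integral>\<^sup>+x. indicator (R (Z x)) t \<partial>M)" for t
    by (subst nn_integral_indicator[symmetric]) (auto intro!: nn_integral_cong simp del: nn_integral_indicator simp: indicator_def)
  have [measurable]: "(\<lambda>z. indicator (R (Z (snd z))) (fst z) :: ennreal) \<in> borel_measurable (borel \<Otimes>\<^sub>M M)"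
    unfolding indicator_def by measurable
  have [measurable]: "(\<lambda>z. indicator (R (Z (fst z))) (snd z) :: ennreal) \<in> borel_measurable (M \<Otimes>\<^sub>M borel)"
    unfolding indicator_def by measurable
  have [measurable]: "(\<lambda>x. indicator (R (Z x)) t :: ennreal) \<in> borel_measurable M" for t
    unfolding indicator_def by measurable
  show ?meas
    unfolding emeasure
    by measurable
  have "(\<integral>\<^sup>+t. g t * emeasure M {x \<in> space M. t \<in> R (Z x)} \<partial>lborel)
      = (\<integral>\<^sup>+t. (\<integral>\<^sup>+x. g t * indicator (R (Z x)) t \<partial>M) \<partial>lborel)"
    unfolding emeasure by (intro nn_integral_cong nn_integral_cmult[symmetric]) simp
  also have "\<dots> = (\<integral>\<^sup>+x. (\<integral>\<^sup>+t. g t * indicator (R (Z x)) t \<partial>lborel) \<partial>M)"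
    by (rule Fubini') (simp add: case_prod_unfold)
  finally show ?eq .
qed

text \<open>Serves twice: with the Levy measure and the identity it gives \<Phi>(l) = l K(l), with
  the probability space and S(r) it brings in the Laplace transform of the subordinator.\<close>

lemma nn_integral_exponential_density_greater:
  assumes Z [measurable]: "Z \<in> borel_measurable M" and nonneg: "AE x in M. 0 \<le> Z x" and l: "0 < l"
  shows "(\<lambda>t. emeasure M {x \<in> space M. t < Z x}) \<in> borel_measurable borel"
    and "(\<integral>\<^sup>+t. ennreal (exponential_density l t) * emeasure M {x \<in> space M. t < Z x} \<partial>lborel)
      = (\<integral>\<^sup>+x. ennreal (1 - exp (- l * Z x)) \<partial>M)"
proof -
  have R: "{z \<in> space (borel \<Otimes>\<^sub>M borel). fst z \<in> {..<snd z}} \<in> sets (borel \<Otimes>\<^sub>M borel :: (real \<times> real) measure)"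
    unfolding lessThan_iff atLeast_iff by measurable
  show "(\<lambda>t. emeasure M {x \<in> space M. t < Z x}) \<in> borel_measurable borel"
    \<comment> \<open>The measurability claim does not mention the weight, so \<open>0\<close> is as
      good as any.\<close>
    using nn_integral_emeasure_level_sets(1)[OF _ Z R, of "\<lambda>_. 0"] by simp
  have "(\<integral>\<^sup>+t. ennreal (exponential_density l t) * emeasure M {x \<in> space M. t < Z x} \<partial>lborel)
      = (\<integral>\<^sup>+x. (\<integral>\<^sup>+t. ennreal (exponential_density l t) * indicator {..<Z x} t \<partial>lborel) \<partial>M)"
    using nn_integral_emeasure_level_sets(2)[OF _ Z R, of "\<lambda>t. ennreal (exponential_density l t)"] by simp
  also have "\<dots> = (\<integral>\<^sup>+x. ennreal (1 - exp (- l * Z x)) \<partial>M)"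
    using nonneg by (intro nn_integral_cong_AE)
      (auto simp: nn_integral_exponential_density_lessThan[OF l])
  finally show "(\<integral>\<^sup>+t. ennreal (exponential_density l t) * emeasure M {x \<in> space M. t < Z x} \<partial>lborel)
      = (\<integral>\<^sup>+x. ennreal (1 - exp (- l * Z x)) \<partial>M)" .
qed

lemma nn_integral_exponential_density_le:
  assumes Y: "Y \<in> borel_measurable M" and nonneg: "AE x in M. 0 \<le> Y x" and l: "0 < l"
  shows "(\<integral>\<^sup>+t. ennreal (exponential_density l t) * emeasure M {x \<in> space M. Y x \<le> t} \<partial>lborel)
      = (\<integral>\<^sup>+x. ennreal (exp (- l * Y x)) \<partial>M)"
proof -
  have R: "{z \<in> space (borel \<Otimes>\<^sub>M borel). fst z \<in> {snd z..}} \<in> sets (borel \<Otimes>\<^sub>M borel :: (real \<times> real) measure)"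
    unfolding lessThan_iff atLeast_iff by measurable
  have "(\<integral>\<^sup>+t. ennreal (exponential_density l t) * emeasure M {x \<in> space M. Y x \<le> t} \<partial>lborel)
      = (\<integral>\<^sup>+x. (\<integral>\<^sup>+t. ennreal (exponential_density l t) * indicator {Y x..} t \<partial>lborel) \<partial>M)"
    using nn_integral_emeasure_level_sets(2)[OF _ Y R, of "\<lambda>t. ennreal (exponential_density l t)"] by simp
  also have "\<dots> = (\<integral>\<^sup>+x. ennreal (exp (- l * Y x)) \<partial>M)"
    using nonneg by (intro nn_integral_cong_AE)
      (auto simp: nn_integral_exponential_density_atLeast[OF l])
  finally show ?thesis .
qed

end

subsection \<open>Laplace exponent and kernel\<close>

text \<open>Markov's inequality: \<open>min 1 \<tau>\<close> is at least \<open>min 1 t > 0\<close>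
  beyond \<open>t\<close>.\<close>

lemma levy_measure_emeasure_greaterThan_finite:
  assumes "levy_measure \<sigma>" "0 < t"
  shows "emeasure \<sigma> {t<..} < \<infinity>"
proof -
  have sets [measurable_cong, simp]: "sets \<sigma> = sets borel"
    using assms by (simp add: levy_measure_def)
  have "ennreal (min 1 t) * emeasure \<sigma> {t<..} = (\<integral>\<^sup>+\<tau>. ennreal (min 1 t) * indicator {t<..} \<tau> \<partial>\<sigma>)"
    by (subst nn_integral_cmult_indicator) auto
  also have "\<dots> \<le> (\<integral>\<^sup>+\<tau>\<in>{0..}. ennreal (min 1 \<tau>) \<partial>\<sigma>)"
    using assms(2) by (intro nn_integral_mono) (auto simp: indicator_def intro!: ennreal_leI)
  also have "\<dots> < \<infinity>"
    using assms(1) by (simp add: levy_measure_def)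
  finally show ?thesis
    using assms(2) by (auto simp: ennreal_mult_less_top ennreal_eq_0_iff)
qed

text \<open>The integrability condition cannot see an atom at 0, since \<open>min 1 \<tau>\<close>
  vanishes there; absolute continuity excludes it.\<close>

lemma levy_measure_AE_pos:
  assumes "levy_measure \<sigma>" "absolutely_continuous lborel \<sigma>"
  shows "AE \<tau> in \<sigma>. 0 < \<tau>"
proof -
  have "{0::real} \<in> null_sets lborel"
    by (simp add: null_sets_def)
  then have "{0} \<in> null_sets \<sigma>" "{..<0} \<in> null_sets \<sigma>"
    using assms by (auto simp: absolutely_continuous_def levy_measure_def)
  then have "{..<0} \<union> {0} \<in> null_sets \<sigma>"
    by (intro null_sets.Un)
  then show ?thesis
    by (rule AE_I') force
qed

text \<open>The tails beyond 1/(n+1) have finite mass and exhaust the positive axis; the rest is a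
  null set.\<close>

lemma levy_measure_sigma_finite:
  assumes "levy_measure \<sigma>" "absolutely_continuous lborel \<sigma>"
  shows "sigma_finite_measure \<sigma>"
proof
  have sets: "sets \<sigma> = sets borel"
    using assms by (simp add: levy_measure_def)
  then have space: "space \<sigma> = UNIV"
    by (metis sets_eq_imp_space_eq space_borel)
  have "emeasure \<sigma> {..0} = 0"
    using levy_measure_AE_pos[OF assms]
    by (subst (asm) AE_iff_measurable[of "{..0}"]) (auto simp: space sets not_less)
  show "\<exists>A. countable A \<and> A \<subseteq> sets \<sigma> \<and> \<Union>A = space \<sigma> \<and> (\<forall>a\<in>A. emeasure \<sigma> a \<noteq> \<infinity>)"
  proof (intro exI[of _ "insert {..0} (range (\<lambda>n. {inverse (real (Suc n))<..}))"] conjI ballI)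
    show "\<Union>(insert {..0} (range (\<lambda>n. {inverse (real (Suc n))<..}))) = space \<sigma>"
    proof -
      have "x \<in> \<Union>(insert {..0} (range (\<lambda>n. {inverse (real (Suc n))<..})))" for x :: real
        using reals_Archimedean[of x] by (cases "0 < x") auto
      then show ?thesis by (auto simp: space)
    qed
    fix a assume "a \<in> insert {..0} (range (\<lambda>n. {inverse (real (Suc n))<..}))"
    then show "emeasure \<sigma> a \<noteq> \<infinity>"
      using \<open>emeasure \<sigma> {..0} = 0\<close> levy_measure_emeasure_greaterThan_finite[OF assms(1)]
      by (auto simp: less_top[symmetric])
  qed (auto simp: sets)
qed

text \<open>Both sides are \<open>enn2real\<close> of one nonnegative integral, the layer-cake
  formula for the Levy measure. The factor \<open>l\<close> is the normalisation of the exponential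
  density.\<close>

lemma
  assumes levy: "levy_measure \<sigma>" and ac: "absolutely_continuous lborel \<sigma>" and l: "0 < l"
  shows laplace_exponent_integrable: "integrable \<sigma> (\<lambda>\<tau>. indicator {0..} \<tau> *\<^sub>R (1 - exp (- l * \<tau>)))"
    and laplace_exponent_eq_kernel_laplace: "laplace_exponent \<sigma> l = l * kernel_laplace \<sigma> l"
proof -
  have sets [measurable_cong, simp]: "sets \<sigma> = sets borel"
    using levy by (simp add: levy_measure_def)
  then have space [simp]: "space \<sigma> = UNIV"
    by (metis sets_eq_imp_space_eq space_borel)
  interpret sigma_finite_measure \<sigma>
    by (rule levy_measure_sigma_finite) fact+
  have pos: "AE \<tau> in \<sigma>. 0 < \<tau>"
    by (rule levy_measure_AE_pos) fact+
  have bound: "1 - exp (- l * \<tau>) \<le> max 1 l * min 1 \<tau>" if "0 \<le> \<tau>" for \<tau>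
  proof -
    have "1 - exp (- l * \<tau>) \<le> l * \<tau>" "1 - exp (- l * \<tau>) \<le> 1"
      using exp_ge_add_one_self[of "- l * \<tau>"] by auto
    moreover have "l * \<tau> \<le> max 1 l * \<tau>"
      using that by (intro mult_right_mono) auto
    moreover have "1 \<le> max 1 l"
      by simp
    moreover have "min 1 \<tau> = 1 \<or> min 1 \<tau> = \<tau>"
      by linarith
    ultimately show ?thesis
      by (elim disjE) (simp_all only: mult_1_right)
  qed
  have "(\<integral>\<^sup>+\<tau>. ennreal (norm (indicator {0..} \<tau> *\<^sub>R (1 - exp (- l * \<tau>)))) \<partial>\<sigma>)
      \<le> (\<integral>\<^sup>+\<tau>. ennreal (max 1 l) * (ennreal (min 1 \<tau>) * indicator {0..} \<tau>) \<partial>\<sigma>)"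
    using bound l by (intro nn_integral_mono)
      (auto simp: indicator_def ennreal_mult[symmetric] intro!: ennreal_leI)
  also have "\<dots> = ennreal (max 1 l) * (\<integral>\<^sup>+\<tau>\<in>{0..}. ennreal (min 1 \<tau>) \<partial>\<sigma>)"
    by (rule nn_integral_cmult) measurable
  also have "\<dots> < \<infinity>"
    using levy by (simp add: levy_measure_def ennreal_mult_less_top)
  finally show int: "integrable \<sigma> (\<lambda>\<tau>. indicator {0..} \<tau> *\<^sub>R (1 - exp (- l * \<tau>)))"
    by (intro integrableI_bounded) auto
  have nonneg: "0 \<le> indicator {0..} \<tau> *\<^sub>R (1 - exp (- l * \<tau>))" for \<tau> :: real
    using l by (auto simp: indicator_def)
  note tail = nn_integral_exponential_density_greater[of "\<lambda>\<tau>. \<tau>" l]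
  have [measurable]: "(\<lambda>t. emeasure \<sigma> {t<..}) \<in> borel_measurable borel"
    using tail(1) pos l by (simp add: greaterThan_def eventually_mono)
  have "laplace_exponent \<sigma> l = enn2real (\<integral>\<^sup>+\<tau>. ennreal (1 - exp (- l * \<tau>)) \<partial>\<sigma>)"
    unfolding laplace_exponent_def set_lebesgue_integral_def
    using nonneg pos
    by (subst integral_eq_nn_integral) (auto intro!: arg_cong[of _ _ enn2real] nn_integral_cong_AE)
  also have "(\<integral>\<^sup>+\<tau>. ennreal (1 - exp (- l * \<tau>)) \<partial>\<sigma>)
      = (\<integral>\<^sup>+t. ennreal (exponential_density l t) * emeasure \<sigma> {t<..} \<partial>lborel)"
    using tail(2) pos l by (simp add: greaterThan_def eventually_mono)
  also have "\<dots> = (\<integral>\<^sup>+t. ennreal (l * (indicator {0<..} t *\<^sub>R (exp (- l * t) * levy_kernel \<sigma> t))) \<partial>lborel)"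
    using AE_lborel_singleton[of "0::real"]
  proof (intro nn_integral_cong_AE, eventually_elim)
    case (elim t)
    show ?case
    proof (cases "0 < t")
      case True
      then have "emeasure \<sigma> {t<..} = ennreal (levy_kernel \<sigma> t)"
        using levy_measure_emeasure_greaterThan_finite[OF levy True]
        by (simp add: levy_kernel_def emeasure_eq_ennreal_measure less_top[symmetric])
      then show ?thesis
        using True l by (simp add: exponential_density_def levy_kernel_def ennreal_mult[symmetric] mult_ac)
    next
      case False
      then show ?thesis
        using elim by (simp add: exponential_density_def)
    qed
  qed
  also have "enn2real \<dots> = (LINT t|lborel. l * (indicator {0<..} t *\<^sub>R (exp (- l * t) * levy_kernel \<sigma> t)))"
    using l by (subst integral_eq_nn_integral) (auto simp: levy_kernel_def measure_def)
  also have "\<dots> = l * kernel_laplace \<sigma> l"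
    unfolding kernel_laplace_def set_lebesgue_integral_def by simp
  finally show "laplace_exponent \<sigma> l = l * kernel_laplace \<sigma> l" .
qed

lemma laplace_exponent_mono:
  assumes "levy_measure \<sigma>" "absolutely_continuous lborel \<sigma>" "0 < l" "l \<le> m"
  shows "laplace_exponent \<sigma> l \<le> laplace_exponent \<sigma> m"
  unfolding laplace_exponent_def set_lebesgue_integral_def
  using assms by (intro integral_mono laplace_exponent_integrable)
    (auto simp: indicator_def mult_right_mono)

subsection \<open>The inverse of a subordinator\<close>

context subordinator
begin

lemma AE_S_mono:
  assumes "0 \<le> r" "r \<le> r'"
  shows "AE \<omega> in M. S r \<omega> \<le> S r' \<omega>"
  using increasing_paths
proof eventually_elim
  case (elim \<omega>)
  then show ?case
    by (rule mono_onD) (use assms in auto)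
qed

lemma AE_S_nonneg:
  assumes "0 \<le> r"
  shows "AE \<omega> in M. 0 \<le> S r \<omega>"
  using AE_S_mono[OF order_refl assms] start_zero by eventually_elim simp

text \<open>Only distribution functions are involved: the tail grows with r because almost all paths
  increase, and it is right-continuous in t as one minus a distribution function. Writing
  \<open>max 0 r\<close> extends it to negative r, where nothing is known about
  \<open>S\<close>.\<close>

lemma tail_measurable:
  "(\<lambda>(r, t). prob {\<omega> \<in> space M. t < S (max 0 r) \<omega>}) \<in> borel_measurable (borel \<Otimes>\<^sub>M borel)"
proof (rule borel_measurable_right_continuous_pair)
  fix t :: real
  show "(\<lambda>r. prob {\<omega> \<in> space M. t < S (max 0 r) \<omega>}) \<in> borel_measurable borel"
  proof (intro borel_measurable_mono monoI)
    fix r r' :: real assume "r \<le> r'"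
    then have "AE \<omega> in M. S (max 0 r) \<omega> \<le> S (max 0 r') \<omega>"
      by (intro AE_S_mono) auto
    then show "prob {\<omega> \<in> space M. t < S (max 0 r) \<omega>} \<le> prob {\<omega> \<in> space M. t < S (max 0 r') \<omega>}"
      using random_variable_S[of "max 0 r'"] by (intro finite_measure_mono_AE) auto
  qed
next
  fix r t :: real
  define D where "D = distr M borel (S (max 0 r))"
  have [measurable]: "S (max 0 r) \<in> borel_measurable M"
    by (rule random_variable_S) simp
  interpret D: real_distribution D
    unfolding D_def by (rule real_distribution_distr) measurable
  have "prob {\<omega> \<in> space M. s < S (max 0 r) \<omega>} = 1 - cdf D s" for s
  proof -
    have "cdf D s = prob {\<omega> \<in> space M. S (max 0 r) \<omega> \<le> s}"
      unfolding cdf_def D_def by (subst measure_distr) (auto intro!: arg_cong[of _ _ prob])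
    moreover have "prob {\<omega> \<in> space M. s < S (max 0 r) \<omega>} = 1 - prob {\<omega> \<in> space M. S (max 0 r) \<omega> \<le> s}"
      by (subst prob_neg[symmetric]) (auto simp: not_le)
    ultimately show ?thesis by simp
  qed
  then show "((\<lambda>s. prob {\<omega> \<in> space M. s < S (max 0 r) \<omega>}) \<longlongrightarrow> prob {\<omega> \<in> space M. t < S (max 0 r) \<omega>}) (at_right t)"
    using D.cdf_is_right_cont[of t] by (auto intro!: tendsto_intros simp: continuous_within)
qed

text \<open>A Chernoff bound: if S stays below t at all positive integer times, then e^(-lS(n))
  \<ge> e^(-lt), whose expectation e^(-np) tends to 0. This keeps the infimum defining E(t) away
  from the empty set.\<close>

lemma AE_exceeds:
  assumes laplace: "\<And>r. 0 \<le> r \<Longrightarrow> expectation (\<lambda>\<omega>. exp (- l * S r \<omega>)) = exp (- r * p)"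
    and l: "0 < l" and p: "0 < p"
  shows "AE \<omega> in M. \<exists>r>0. t < S r \<omega>"
proof -
  define A where "A = {\<omega> \<in> space M. \<forall>n. S (real (Suc n)) \<omega> \<le> t}"
  have S_meas [measurable]: "S (real (Suc n)) \<in> borel_measurable M" for n
    by (rule random_variable_S) simp
  have A [measurable]: "A \<in> sets M"
    unfolding A_def by measurable
  have le: "exp (- l * t) * prob A \<le> exp (- p) ^ Suc n" for n
  proof -
    have int: "integrable M (\<lambda>\<omega>. exp (- l * S (real (Suc n)) \<omega>))"
    proof (rule integrable_const_bound[of _ 1])
      show "AE \<omega> in M. norm (exp (- l * S (real (Suc n)) \<omega>)) \<le> 1"
        using AE_S_nonneg[of "real (Suc n)"] l by (auto elim!: eventually_mono)
    qed measurable
    have "exp (- l * t) * prob A = expectation (\<lambda>\<omega>. exp (- l * t) * indicator A \<omega>)"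
      by simp
    also have "\<dots> \<le> expectation (\<lambda>\<omega>. exp (- l * S (real (Suc n)) \<omega>))"
    proof (rule integral_mono[OF _ int])
      show "integrable M (\<lambda>\<omega>. exp (- l * t) * indicator A \<omega>)"
        by (intro integrable_mult_right integrable_real_indicator) (auto simp: less_top[symmetric])
      show "exp (- l * t) * indicator A \<omega> \<le> exp (- l * S (real (Suc n)) \<omega>)" for \<omega>
        using l by (cases "\<omega> \<in> A") (auto simp: A_def simp del: of_nat_Suc)
    qed
    also have "\<dots> = exp (- p) ^ Suc n"
      by (subst laplace) (auto simp: exp_of_nat_mult[symmetric] simp del: of_nat_Suc power_Suc)
    finally show ?thesis .
  qed
  have "(\<lambda>n. exp (- p) ^ Suc n) \<longlonglongrightarrow> 0"
    using LIMSEQ_power_zero[of "exp (- p)"] p by (intro LIMSEQ_Suc) simp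
  then have "exp (- l * t) * prob A \<le> 0"
    by (rule LIMSEQ_le_const) (use le in auto)
  then have "prob A = 0"
    using measure_nonneg[of M A] by (simp add: mult_le_0_iff)
  then have "AE \<omega> in M. \<omega> \<notin> A"
    using A prob_eq_0 by blast
  then show ?thesis
    using AE_space
  proof eventually_elim
    case (elim \<omega>)
    then obtain n where "t < S (real (Suc n)) \<omega>"
      by (auto simp: A_def not_le)
    then show ?case
      by (intro exI[of _ "real (Suc n)"]) simp
  qed
qed

text \<open>Up to null sets, for r > 0, E(t) < r implies S(r) > t, which implies E(t) \<le> r. The
  quantifier over r stands inside \<open>AE\<close>: one null set serves all r.\<close>

lemma
  assumes exceeds: "AE \<omega> in M. \<exists>r>0. t < S r \<omega>"
  shows AE_inverse_process_less: "AE \<omega> in M. \<forall>r. inverse_process S t \<omega> < r \<longrightarrow> t < S r \<omega>"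
    and AE_inverse_process_le: "AE \<omega> in M. \<forall>r>0. t < S r \<omega> \<longrightarrow> inverse_process S t \<omega> \<le> r"
    and AE_inverse_process_nonneg: "AE \<omega> in M. 0 \<le> inverse_process S t \<omega>"
proof -
  have bdd: "bdd_below {r. 0 < r \<and> t < S r \<omega>}" for \<omega>
    by (rule bdd_belowI[of _ 0]) auto
  show "AE \<omega> in M. \<forall>r. inverse_process S t \<omega> < r \<longrightarrow> t < S r \<omega>"
    using exceeds increasing_paths
  proof eventually_elim
    case (elim \<omega>)
    show ?case
    proof (intro allI impI)
      fix r assume "inverse_process S t \<omega> < r"
      then obtain r' where "0 < r'" "t < S r' \<omega>" "r' < r"
        using elim(1) bdd[of \<omega>] by (auto simp: inverse_process_def cInf_less_iff)
      moreover have "S r' \<omega> \<le> S r \<omega>"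
        using elim(2) by (rule mono_onD) (use \<open>0 < r'\<close> \<open>r' < r\<close> in auto)
      ultimately show "t < S r \<omega>" by simp
    qed
  qed
  show "AE \<omega> in M. \<forall>r>0. t < S r \<omega> \<longrightarrow> inverse_process S t \<omega> \<le> r"
    unfolding inverse_process_def by (intro AE_I2 allI impI cInf_lower bdd) auto
  show "AE \<omega> in M. 0 \<le> inverse_process S t \<omega>"
    using exceeds unfolding inverse_process_def
    by eventually_elim (intro cInf_greatest, auto)
qed

lemma expectation_exp_inverse_process:
  assumes exceeds: "AE \<omega> in M. \<exists>r>0. t < S r \<omega>"
    and meas [measurable]: "inverse_process S t \<in> borel_measurable M"
    and no_atoms: "\<And>r. AE \<omega> in M. inverse_process S t \<omega> \<noteq> r"
    and a: "0 < a"
  shows "ennreal (expectation (\<lambda>\<omega>. exp (- a * inverse_process S t \<omega>)))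
    = (\<integral>\<^sup>+r. ennreal (exponential_density a r * prob {\<omega> \<in> space M. t < S (max 0 r) \<omega>}) \<partial>lborel)"
proof -
  note nonneg = AE_inverse_process_nonneg[OF exceeds]
  have int: "integrable M (\<lambda>\<omega>. exp (- a * inverse_process S t \<omega>))"
  proof (rule integrable_const_bound[of _ 1])
    show "AE \<omega> in M. norm (exp (- a * inverse_process S t \<omega>)) \<le> 1"
      using nonneg a by (auto elim!: eventually_mono)
  qed measurable
  have prob_eq: "prob {\<omega> \<in> space M. inverse_process S t \<omega> \<le> r} = prob {\<omega> \<in> space M. t < S r \<omega>}"
    if r: "0 < r" for r
  proof -
    have [measurable]: "S r \<in> borel_measurable M"
      using r by (intro random_variable_S) simp
    \<comment> \<open>Absence of atoms improves E(t) \<le> r to E(t) < r, closing the gap between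
      the two implications.\<close>
    have "AE \<omega> in M. inverse_process S t \<omega> \<le> r \<longleftrightarrow> t < S r \<omega>"
      using AE_inverse_process_less[OF exceeds] AE_inverse_process_le[OF exceeds] no_atoms[of r]
      by eventually_elim (use r in force)
    then show ?thesis
      by (intro measure_eq_AE) auto
  qed
  have "ennreal (expectation (\<lambda>\<omega>. exp (- a * inverse_process S t \<omega>)))
      = (\<integral>\<^sup>+\<omega>. ennreal (exp (- a * inverse_process S t \<omega>)) \<partial>M)"
    using int by (subst nn_integral_eq_integral) auto
  also have "\<dots> = (\<integral>\<^sup>+r. ennreal (exponential_density a r) *
      emeasure M {\<omega> \<in> space M. inverse_process S t \<omega> \<le> r} \<partial>lborel)"
    using nonneg a by (subst nn_integral_exponential_density_le) auto
  also have "\<dots> = (\<integral>\<^sup>+r. ennreal (exponential_density a r * prob {\<omega> \<in> space M. t < S (max 0 r) \<omega>}) \<partial>lborel)"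
    using AE_lborel_singleton[of "0::real"]
  proof (intro nn_integral_cong_AE, eventually_elim)
    case (elim r)
    show ?case
      using elim prob_eq[of r] a
      by (cases "0 < r") (auto simp: exponential_density_def[of a r] emeasure_eq_measure ennreal_mult)
  qed
  finally show ?thesis .
qed

text \<open>Everything is read off from the representation \<open>W\<close> by tails of S: these
  decrease in t, and Tonelli allows t to be integrated first, at fixed r, where the Laplace
  transform of S(r) is known.\<close>

lemma
  fixes a :: real
  defines "v \<equiv> \<lambda>t. expectation (\<lambda>\<omega>. exp (- a * inverse_process S t \<omega>))"
  assumes a: "0 < a"
    and exceeds: "\<And>t. AE \<omega> in M. \<exists>r>0. t < S r \<omega>"
    and meas: "\<And>t. 0 < t \<Longrightarrow> inverse_process S t \<in> borel_measurable M"
    and no_atoms: "\<And>t r. 0 < t \<Longrightarrow> AE \<omega> in M. inverse_process S t \<omega> \<noteq> r"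
  shows expectation_exp_inverse_process_antimono: "0 < s \<Longrightarrow> s \<le> t \<Longrightarrow> v t \<le> v s"
    and laplace_transform_exp_inverse_process:
      "0 < l \<Longrightarrow> 0 \<le> p \<Longrightarrow> (\<And>r. 0 \<le> r \<Longrightarrow> expectation (\<lambda>\<omega>. exp (- l * S r \<omega>)) = exp (- r * p)) \<Longrightarrow>
       has_bochner_integral lborel (\<lambda>t. indicator {0<..} t * (exp (- l * t) * v t)) (p / (l * (a + p)))"
proof -
  define h where "h r t = prob {\<omega> \<in> space M. t < S (max 0 r) \<omega>}" for r t
  define W where "W t = (\<integral>\<^sup>+r. ennreal (exponential_density a r * h r t) \<partial>lborel)" for t
  have v: "ennreal (v t) = W t" if "0 < t" for t
    unfolding v_def W_def h_def
    by (intro expectation_exp_inverse_process exceeds meas no_atoms a that)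
  have v_nonneg: "0 \<le> v t" for t
    unfolding v_def by (intro integral_nonneg_AE) simp
  have h_nonneg: "0 \<le> h r t" for r t
    by (simp add: h_def)
  note ed_nonneg = exponential_density_nonneg[OF a]
  show "v t \<le> v s" if "0 < s" "s \<le> t"
  proof -
    have "h r t \<le> h r s" for r
      unfolding h_def using that random_variable_S[of "max 0 r"] by (intro finite_measure_mono) auto
    then have "W t \<le> W s"
      unfolding W_def by (intro nn_integral_mono ennreal_leI mult_left_mono ed_nonneg) auto
    then have "ennreal (v t) \<le> ennreal (v s)"
      using that by (simp add: v)
    then show ?thesis
      using v_nonneg[of s] by (rule ennreal_le_iff[THEN iffD1, rotated])
  qed
  have h_meas [measurable]: "(\<lambda>z. h (fst z) (snd z)) \<in> borel_measurable (borel \<Otimes>\<^sub>M borel)"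
    using tail_measurable unfolding h_def case_prod_unfold .
  have h_meas' [measurable]: "(\<lambda>z. h (snd z) (fst z)) \<in> borel_measurable (borel \<Otimes>\<^sub>M borel)"
  proof -
    have "(\<lambda>z. (snd z, fst z)) \<in> borel \<Otimes>\<^sub>M borel \<rightarrow>\<^sub>M borel \<Otimes>\<^sub>M (borel :: real measure)"
      by measurable
    from measurable_compose[OF this h_meas] show ?thesis by simp
  qed
  have [measurable]: "(\<lambda>r. h r t) \<in> borel_measurable borel" for t
    using measurable_compose[OF measurable_Pair1' h_meas', of t] by simp
  have [measurable]: "(\<lambda>t. h r t) \<in> borel_measurable borel" for r
    using measurable_compose[OF measurable_Pair1' h_meas, of r] by simp
  have W_meas [measurable]: "W \<in> borel_measurable borel"
    unfolding W_def by (rule lborel.borel_measurable_nn_integral) (simp add: case_prod_unfold)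
  show "has_bochner_integral lborel (\<lambda>t. indicator {0<..} t * (exp (- l * t) * v t)) (p / (l * (a + p)))"
    if l: "0 < l" and p: "0 \<le> p"
      and laplace: "\<And>r. 0 \<le> r \<Longrightarrow> expectation (\<lambda>\<omega>. exp (- l * S r \<omega>)) = exp (- r * p)"
  proof (rule has_bochner_integral_nn_integral)
    have inner: "(\<integral>\<^sup>+t. ennreal (exponential_density l t) * ennreal (h r t) \<partial>lborel) = ennreal (1 - exp (- r * p))"
      if "0 \<le> r" for r
    proof -
      note [measurable] = random_variable_S[OF that]
      have int: "integrable M (\<lambda>\<omega>. exp (- l * S r \<omega>))"
      proof (rule integrable_const_bound[of _ 1])
        show "AE \<omega> in M. norm (exp (- l * S r \<omega>)) \<le> 1"
          using AE_S_nonneg[OF that] l by (auto elim!: eventually_mono)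
      qed measurable
      have "(\<integral>\<^sup>+t. ennreal (exponential_density l t) * ennreal (h r t) \<partial>lborel)
          = (\<integral>\<^sup>+\<omega>. ennreal (1 - exp (- l * S r \<omega>)) \<partial>M)"
        using nn_integral_exponential_density_greater(2)[OF _ AE_S_nonneg[OF that] l] that
        by (simp add: h_def emeasure_eq_measure max_def)
      also have "\<dots> = ennreal (expectation (\<lambda>\<omega>. 1 - exp (- l * S r \<omega>)))"
        using int AE_S_nonneg[OF that] l
        by (intro nn_integral_eq_integral) (auto elim!: eventually_mono)
      also have "expectation (\<lambda>\<omega>. 1 - exp (- l * S r \<omega>)) = 1 - exp (- r * p)"
        using int laplace[OF that] by (simp add: prob_space)
      finally show ?thesis .
    qed
    have "ennreal l * (\<integral>\<^sup>+t. ennreal (indicator {0<..} t * (exp (- l * t) * v t)) \<partial>lborel)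
        = (\<integral>\<^sup>+t. ennreal (exponential_density l t) * W t \<partial>lborel)"
    proof -
      have "(\<lambda>t. ennreal (indicator {0<..} t * (exp (- l * t) * v t)))
          = (\<lambda>t. ennreal (indicator {0<..} t * exp (- l * t)) * W t)"
        using v_nonneg by (auto simp: fun_eq_iff indicator_def ennreal_mult v)
      then have "ennreal l * (\<integral>\<^sup>+t. ennreal (indicator {0<..} t * (exp (- l * t) * v t)) \<partial>lborel)
          = (\<integral>\<^sup>+t. ennreal l * (ennreal (indicator {0<..} t * exp (- l * t)) * W t) \<partial>lborel)"
        by (simp add: nn_integral_cmult)
      also have "\<dots> = (\<integral>\<^sup>+t. ennreal (exponential_density l t) * W t \<partial>lborel)"
        using AE_lborel_singleton[of "0::real"]
      proof (intro nn_integral_cong_AE, eventually_elim)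
        case (elim t)
        then show ?case
          using l by (cases "0 < t") (simp_all add: exponential_density_def ennreal_mult mult.assoc mult.commute[of t l] less_imp_le)
      qed
      finally show ?thesis .
    qed
    also have "\<dots> = (\<integral>\<^sup>+t. (\<integral>\<^sup>+r. ennreal (exponential_density l t) * ennreal (exponential_density a r * h r t) \<partial>lborel) \<partial>lborel)"
      unfolding W_def by (intro nn_integral_cong nn_integral_cmult[symmetric]) measurable
    also have "\<dots> = (\<integral>\<^sup>+r. (\<integral>\<^sup>+t. ennreal (exponential_density l t) * ennreal (exponential_density a r * h r t) \<partial>lborel) \<partial>lborel)"
      by (rule lborel_pair.Fubini'[symmetric]) (simp add: case_prod_unfold)
    also have "\<dots> = (\<integral>\<^sup>+r. ennreal (exponential_density a r) *
        (\<integral>\<^sup>+t. ennreal (exponential_density l t) * ennreal (h r t) \<partial>lborel) \<partial>lborel)"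
    proof (intro nn_integral_cong)
      fix r :: real
      have "(\<integral>\<^sup>+t. ennreal (exponential_density l t) * ennreal (exponential_density a r * h r t) \<partial>lborel)
          = (\<integral>\<^sup>+t. ennreal (exponential_density a r) * (ennreal (exponential_density l t) * ennreal (h r t)) \<partial>lborel)"
        by (intro nn_integral_cong) (simp only: ennreal_mult[OF ed_nonneg h_nonneg] mult.left_commute)
      also have "\<dots> = ennreal (exponential_density a r) *
          (\<integral>\<^sup>+t. ennreal (exponential_density l t) * ennreal (h r t) \<partial>lborel)"
        by (rule nn_integral_cmult) measurable
      finally show "(\<integral>\<^sup>+t. ennreal (exponential_density l t) * ennreal (exponential_density a r * h r t) \<partial>lborel)
          = ennreal (exponential_density a r) *
            (\<integral>\<^sup>+t. ennreal (exponential_density l t) * ennreal (h r t) \<partial>lborel)" .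
    qed
    also have "\<dots> = (\<integral>\<^sup>+r. ennreal (exponential_density a r) * ennreal (1 - exp (- r * p)) \<partial>lborel)"
    proof (intro nn_integral_cong)
      fix r :: real
      show "ennreal (exponential_density a r) * (\<integral>\<^sup>+t. ennreal (exponential_density l t) * ennreal (h r t) \<partial>lborel)
          = ennreal (exponential_density a r) * ennreal (1 - exp (- r * p))"
        by (cases "0 \<le> r") (simp_all add: inner exponential_density_def[of a])
    qed
    also have "\<dots> = ennreal (p / (a + p))"
      by (rule nn_integral_exponential_density_times_compl_exp[OF a p])
    finally have *: "ennreal l * (\<integral>\<^sup>+t. ennreal (indicator {0<..} t * (exp (- l * t) * v t)) \<partial>lborel)
        = ennreal (p / (a + p))" .
    have "(\<integral>\<^sup>+t. ennreal (indicator {0<..} t * (exp (- l * t) * v t)) \<partial>lborel)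
        = ennreal (inverse l) * (ennreal l * (\<integral>\<^sup>+t. ennreal (indicator {0<..} t * (exp (- l * t) * v t)) \<partial>lborel))"
      using l by (simp add: mult.assoc[symmetric] ennreal_mult[symmetric])
    also have "\<dots> = ennreal (p / (l * (a + p)))"
      unfolding * using a p l by (simp add: ennreal_mult[symmetric] field_simps)
    finally show "(\<integral>\<^sup>+t. ennreal (indicator {0<..} t * (exp (- l * t) * v t)) \<partial>lborel)
        = ennreal (p / (l * (a + p)))" .
    \<comment> \<open>Measurability of \<open>v\<close> in t comes from \<open>W\<close>, since
      measurability of E(t) is available for each t separately only.\<close>
    have "(\<lambda>t. indicator {0<..} t * (exp (- l * t) * v t))
        = (\<lambda>t. indicator {0<..} t * (exp (- l * t) * enn2real (W t)))"
      using v_nonneg by (auto simp: fun_eq_iff indicator_def simp flip: v)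
    then show "(\<lambda>t. indicator {0<..} t * (exp (- l * t) * v t)) \<in> borel_measurable lborel"
      by simp
  qed (use v_nonneg a p l in auto)
qed

end

subsection \<open>Asymptotics\<close>

text \<open>Division by zero yields \<open>0\<close>, so a quotient close to \<open>1\<close> forces
  a nonzero denominator.\<close>

lemma slowly_varying_eventually_nonzero:
  assumes "slowly_varying Q"
  shows "\<forall>\<^sub>F x in at_top. Q x \<noteq> 0"
proof -
  have "((\<lambda>x. Q (2 * x) / Q x) \<longlongrightarrow> 1) at_top"
    using assms by (simp add: slowly_varying_def)
  then have "\<forall>\<^sub>F x in at_top. 0 < Q (2 * x) / Q x"
    by (rule order_tendstoD) simp
  then show ?thesis
    by (rule eventually_mono) auto
qed

lemma filterlim_divide_at_right_0: "filterlim (\<lambda>l. 1 / l :: real) at_top (at_right 0)"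
  using filterlim_inverse_at_top_right by (simp add: inverse_eq_divide)

text \<open>The relation of asymptotic equivalence counts 0/0 as 1; a nonvanishing right-hand side
  turns it into an ordinary limit.\<close>

lemma asymp_equiv_slowly_varying_tendsto:
  assumes K: "K \<sim>[at_right 0] (\<lambda>l. l powr (- \<gamma>) * Q (1 / l))" and Q: "slowly_varying Q"
  shows "\<forall>\<^sub>F l in at_right 0. l powr (- \<gamma>) * Q (1 / l) \<noteq> 0"
    and "((\<lambda>l. K l / (l powr (- \<gamma>) * Q (1 / l))) \<longlongrightarrow> 1) (at_right 0)"
proof -
  have "\<forall>\<^sub>F l in at_right 0. Q (1 / l) \<noteq> 0"
    using filterlim_divide_at_right_0 slowly_varying_eventually_nonzero[OF Q]
    by (rule eventually_compose_filterlim[rotated])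
  then show nz: "\<forall>\<^sub>F l in at_right 0. l powr (- \<gamma>) * Q (1 / l) \<noteq> 0"
    using eventually_at_right_less[of 0] by eventually_elim simp
  show "((\<lambda>l. K l / (l powr (- \<gamma>) * Q (1 / l))) \<longlongrightarrow> 1) (at_right 0)"
    by (rule asymp_equivD_strong[OF K]) (use nz in \<open>auto elim: eventually_mono\<close>)
qed

lemma filterlim_mult_pos_at_right_0:
  fixes c :: real
  assumes "0 < c"
  shows "filterlim (\<lambda>l. c * l) (at_right 0) (at_right 0)"
  using assms by (intro filterlim_times_pos[of "\<lambda>l. l" 0 "at_right 0" c 0]) (auto simp: filterlim_ident)

lemma regularly_varying_at_right_0:
  assumes K: "K \<sim>[at_right 0] (\<lambda>l. l powr (- \<gamma>) * Q (1 / l))"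
    and Q: "slowly_varying Q" and c: "0 < c"
  shows "((\<lambda>l. K (c * l) / K l) \<longlongrightarrow> c powr (- \<gamma>)) (at_right 0)"
proof -
  define g where "g l = l powr (- \<gamma>) * Q (1 / l)" for l
  note nz = asymp_equiv_slowly_varying_tendsto(1)[OF K Q, folded g_def]
  note ratio = asymp_equiv_slowly_varying_tendsto(2)[OF K Q, folded g_def]
  note scale = filterlim_mult_pos_at_right_0[OF c]
  \<comment> \<open>\<open>Q\<close> is evaluated at 1/(c l), hence the factor
    \<open>inverse c\<close>.\<close>
  have "((\<lambda>x. Q (inverse c * x) / Q x) \<longlongrightarrow> 1) at_top"
    using Q c by (simp add: slowly_varying_def)
  from filterlim_compose[OF this filterlim_divide_at_right_0]
  have "((\<lambda>l. c powr (- \<gamma>) * (Q (inverse c * (1 / l)) / Q (1 / l))) \<longlongrightarrow> c powr (- \<gamma>) * 1) (at_right 0)"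
    by (intro tendsto_intros)
  moreover have "\<forall>\<^sub>F l in at_right 0. c powr (- \<gamma>) * (Q (inverse c * (1 / l)) / Q (1 / l)) = g (c * l) / g l"
    by (rule eventually_at_right_less[THEN eventually_mono])
      (use c in \<open>simp add: g_def powr_mult field_simps\<close>)
  ultimately have g: "((\<lambda>l. g (c * l) / g l) \<longlongrightarrow> c powr (- \<gamma>)) (at_right 0)"
    by (simp add: Lim_transform_eventually)
  have "((\<lambda>l. K (c * l) / g (c * l) / (K l / g l) * (g (c * l) / g l)) \<longlongrightarrow> 1 / 1 * c powr (- \<gamma>)) (at_right 0)"
    by (intro tendsto_intros ratio g filterlim_compose[OF ratio scale]) simp
  moreover have "\<forall>\<^sub>F l in at_right 0. K (c * l) / g (c * l) / (K l / g l) * (g (c * l) / g l) = K (c * l) / K l"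
    using nz eventually_compose_filterlim[OF nz scale] by eventually_elim simp
  ultimately show ?thesis
    by (simp add: Lim_transform_eventually)
qed

theorem proposition3p1:
  fixes M :: "'a measure" and S :: "real \<Rightarrow> 'a \<Rightarrow> real" and \<sigma> :: "real measure"
    and G :: "real \<Rightarrow> real \<Rightarrow> real" and Q :: "real \<Rightarrow> real" and \<alpha> \<gamma> :: real
    and w :: "real ^ 'd" and X :: "real \<Rightarrow> real ^ 'd" and f :: "real ^ 'd \<Rightarrow> real"
    and u v :: "real \<Rightarrow> real"
  assumes w: "w \<noteq> 0"
    and X: "X = (\<lambda>t. t *\<^sub>R w)"
    and \<alpha>: "0 < \<alpha>"
    and f: "f = (\<lambda>x. exp (- \<alpha> * norm x))"
    and u: "u = (\<lambda>t. f (X t))"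
    and S: "subordinator M S"
    and \<sigma>: "has_levy_measure M S \<sigma>"
    and G: "\<And>t. 0 < t \<Longrightarrow> nonneg_density M (inverse_process S t) (G t)"
    and abs_cont: "absolutely_continuous lborel \<sigma>"
    and K_0: "filterlim (kernel_laplace \<sigma>) at_top (at_right 0)"
    and \<Phi>_0: "(laplace_exponent \<sigma> \<longlongrightarrow> 0) (at_right 0)"
    and K_inf: "(kernel_laplace \<sigma> \<longlongrightarrow> 0) at_top"
    and \<Phi>_inf: "filterlim (laplace_exponent \<sigma>) at_top at_top"
    and \<gamma>: "0 \<le> \<gamma>" "\<gamma> \<le> 1"
    and Q: "slowly_varying Q"
    and K_asymp: "kernel_laplace \<sigma> \<sim>[at_right 0] (\<lambda>l. l powr (- \<gamma>) * Q (1 / l))"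
    and v: "v = (\<lambda>t. \<integral>\<omega>. f (X (inverse_process S t \<omega>)) \<partial>M)"
  shows "(\<forall>t\<ge>0. u t = exp (- \<alpha> * t * norm w)) \<and>
    (\<forall>t>0. v t = (LINT \<tau>:{0..}|lborel. u \<tau> * G t \<tau>)) \<and>
    (0 < \<gamma> \<longrightarrow> v \<sim>[at_top] (\<lambda>t. 1 / (\<alpha> * norm w * Gamma \<gamma>) * t powr (\<gamma> - 1) * Q t)) \<and>
    \<comment> \<open>\<open>1 / \<Gamma>(0) = 0\<close>, and being asymptotic to \<open>0\<close> times a function means little-o of it\<close>
    (\<gamma> = 0 \<longrightarrow> v \<in> o[at_top](\<lambda>t. t powr (\<gamma> - 1) * Q t))"
proof -
  interpret subordinator M S by fact
  define a where "a = \<alpha> * norm w"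
  define K where "K = kernel_laplace \<sigma>"
  define \<Phi> where "\<Phi> = laplace_exponent \<sigma>"
  have a: "0 < a"
    using w \<alpha> by (simp add: a_def)
  have laplace: "expectation (\<lambda>\<omega>. exp (- l * S r \<omega>)) = exp (- r * \<Phi> l)" if "0 \<le> l" "0 \<le> r" for l r
    using \<sigma> that by (auto simp: has_levy_measure_def \<Phi>_def)
  have levy: "levy_measure \<sigma>"
    using \<sigma> by (simp add: has_levy_measure_def)
  have \<Phi>_eq: "\<Phi> l = l * K l" if "0 < l" for l
    unfolding \<Phi>_def K_def by (rule laplace_exponent_eq_kernel_laplace[OF levy abs_cont that])
  have K_ev: "\<forall>\<^sub>F l in at_right 0. 1 \<le> K l"
    using K_0 unfolding K_def filterlim_at_top by blast
  \<comment> \<open>Blow-up of K at 0 makes \<Phi>(m) = m K(m) positive at some m < l, and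
    monotonicity carries this to l.\<close>
  have \<Phi>_pos: "0 < \<Phi> l" if "0 < l" for l
  proof -
    have "\<forall>\<^sub>F m in at_right 0. 1 \<le> K m \<and> m \<in> {0<..<l}"
      using K_ev eventually_at_right_real[OF that] by (rule eventually_conj)
    then obtain m where m: "1 \<le> K m" "0 < m" "m < l"
      using eventually_happens[of _ "at_right (0::real)"] trivial_limit_at_right_real[of "0::real"] by auto
    then have "0 < \<Phi> m"
      by (simp add: \<Phi>_eq)
    also have "\<Phi> m \<le> \<Phi> l"
      unfolding \<Phi>_def using m by (intro laplace_exponent_mono levy abs_cont) auto
    finally show ?thesis .
  qed

  have dens: "distributed M lborel (inverse_process S t) (\<lambda>\<tau>. ennreal (indicator {0..} \<tau> * G t \<tau>))"
    "\<And>\<tau>. 0 \<le> \<tau> \<Longrightarrow> 0 \<le> G t \<tau>" if "0 < t" for t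
    using G[OF that] by (auto simp: nonneg_density_def)
  have meas: "inverse_process S t \<in> borel_measurable M" if "0 < t" for t
    using distributed_measurable[OF dens(1)[OF that]] by simp
  have no_atoms: "AE \<omega> in M. inverse_process S t \<omega> \<noteq> r" if "0 < t" for t r
  proof -
    have "emeasure M (inverse_process S t -` {r} \<inter> space M)
        = (\<integral>\<^sup>+\<tau>. ennreal (indicator {0..} \<tau> * G t \<tau>) * indicator {r} \<tau> \<partial>lborel)"
      by (rule distributed_emeasure[OF dens(1)[OF that]]) simp
    also have "\<dots> = (\<integral>\<^sup>+\<tau>. 0 \<partial>(lborel :: real measure))"
      using AE_lborel_singleton[of r] by (intro nn_integral_cong_AE) (auto elim!: eventually_mono)
    finally have "inverse_process S t -` {r} \<inter> space M \<in> null_sets M"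
      using meas[OF that] by (auto simp: null_sets_def)
    then show ?thesis
      by (rule AE_I') auto
  qed
  have exceeds: "AE \<omega> in M. \<exists>r>0. t < S r \<omega>" for t
    by (rule AE_exceeds[OF laplace[of 1] _ \<Phi>_pos]) auto

  have u_eq: "u t = exp (- \<alpha> * t * norm w)" if "0 \<le> t" for t
    using that by (simp add: u f X)
  define V where "V t = expectation (\<lambda>\<omega>. exp (- a * inverse_process S t \<omega>))" for t
  \<comment> \<open>The norm of E(t) w is |E(t)| |w|, so the identification rests on E(t) being
    almost surely nonnegative.\<close>
  have v_V: "v t = V t" if "0 < t" for t
    unfolding v V_def
  proof (rule integral_cong_AE)
    show "AE \<omega> in M. f (X (inverse_process S t \<omega>)) = exp (- a * inverse_process S t \<omega>)"
      using AE_inverse_process_nonneg[OF exceeds[of t]]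
      by eventually_elim (simp add: f X a_def)
  qed (use meas[OF that] in \<open>simp_all add: f X\<close>)
  have v_density: "v t = (LINT \<tau>:{0..}|lborel. u \<tau> * G t \<tau>)" if "0 < t" for t
  proof -
    have "v t = (\<integral>\<tau>. (indicator {0..} \<tau> * G t \<tau>) * f (X \<tau>) \<partial>lborel)"
      unfolding v
      by (rule distributed_integral[OF dens(1)[OF that], symmetric])
        (use dens(2)[OF that] in \<open>auto simp: f X indicator_def\<close>)
    also have "\<dots> = (LINT \<tau>:{0..}|lborel. u \<tau> * G t \<tau>)"
      unfolding set_lebesgue_integral_def by (simp add: u mult_ac)
    finally show ?thesis .
  qed

  define L where "L l = \<Phi> l / (l * (a + \<Phi> l))" for l
  have L_eq: "L l = K l / (a + \<Phi> l)" if "0 < l" for l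
    using that \<Phi>_eq[OF that] by (simp add: L_def)
  have regular: "((\<lambda>l. L (c * l) / L l) \<longlongrightarrow> c powr (- \<gamma>)) (at_right 0)" if c: "0 < c" for c
  proof -
    from \<Phi>_0 filterlim_mult_pos_at_right_0[OF c] have "((\<lambda>l. \<Phi> (c * l)) \<longlongrightarrow> 0) (at_right 0)"
      unfolding \<Phi>_def by (rule filterlim_compose)
    \<comment> \<open>L inherits the index of K, because \<Phi> tends to 0 and the correction factor
      to 1.\<close>
    then have "((\<lambda>l. K (c * l) / K l * ((a + \<Phi> l) / (a + \<Phi> (c * l)))) \<longlongrightarrow> c powr (- \<gamma>) * ((a + 0) / (a + 0))) (at_right 0)"
      using a \<Phi>_0 unfolding K_def
      by (intro tendsto_intros regularly_varying_at_right_0[OF K_asymp Q c]) (auto simp: \<Phi>_def)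
    then have "((\<lambda>l. K (c * l) / K l * ((a + \<Phi> l) / (a + \<Phi> (c * l)))) \<longlongrightarrow> c powr (- \<gamma>)) (at_right 0)"
      using a by simp
    then show ?thesis
      by (rule Lim_transform_eventually, intro eventually_at_right_less[THEN eventually_mono])
        (use c in \<open>simp add: L_eq\<close>)
  qed
  have V_nonneg: "0 \<le> V t" for t
    unfolding V_def by (intro integral_nonneg_AE) simp
  have V_antimono: "V t \<le> V s" if "0 < s" "s \<le> t" for s t
    unfolding V_def by (rule expectation_exp_inverse_process_antimono[OF a exceeds meas no_atoms that])
  have V_laplace: "has_bochner_integral lborel (\<lambda>t. indicator {0<..} t * (exp (- l * t) * V t)) (L l)"
    if "0 < l" for l
    unfolding V_def L_def
    by (rule laplace_transform_exp_inverse_process[OF a exceeds meas no_atoms that])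
      (use that laplace \<Phi>_pos[OF that] in auto)
  have "((\<lambda>l. V (1 / l) / (l * L l)) \<longlongrightarrow> rGamma \<gamma>) (at_right 0)"
    by (rule antimono_Tauberian[OF \<gamma> V_nonneg V_antimono V_laplace _ regular])
      (use \<Phi>_pos a in \<open>auto simp: L_def intro!: divide_pos_pos mult_pos_pos add_pos_pos\<close>)
  moreover have "((\<lambda>l. K l / (l powr (- \<gamma>) * Q (1 / l))) \<longlongrightarrow> 1) (at_right 0)"
    unfolding K_def by (rule asymp_equiv_slowly_varying_tendsto[OF K_asymp Q])
  \<comment> \<open>As L = K / (a + \<Phi>), the product telescopes, with the regularly varying
    model of K replacing L; this is where the factor 1/a arises.\<close>
  ultimately have "((\<lambda>l. V (1 / l) / (l * L l) * (K l / (l powr (- \<gamma>) * Q (1 / l))) * (1 / (a + \<Phi> l)))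
      \<longlongrightarrow> rGamma \<gamma> * 1 * (1 / (a + 0))) (at_right 0)"
    using a \<Phi>_0 by (intro tendsto_intros) (auto simp: \<Phi>_def)
  moreover have "\<forall>\<^sub>F l in at_right 0. V (1 / l) / (l * L l) * (K l / (l powr (- \<gamma>) * Q (1 / l))) * (1 / (a + \<Phi> l))
      = V (1 / l) / (l * (l powr (- \<gamma>) * Q (1 / l)))"
    using K_ev eventually_at_right_less[of 0]
  proof eventually_elim
    case (elim l)
    then have "K l \<noteq> 0" "a + \<Phi> l \<noteq> 0"
      using a \<Phi>_pos[of l] by auto
    then show ?case
      unfolding L_eq[OF elim(2)] by simp
  qed
  ultimately have "((\<lambda>l. V (1 / l) / (l * (l powr (- \<gamma>) * Q (1 / l)))) \<longlongrightarrow> rGamma \<gamma> / a) (at_right 0)"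
    by (simp add: Lim_transform_eventually)
  moreover have "filterlim (\<lambda>t. inverse t :: real) (at_right 0) at_top"
    by (rule filterlim_inverse_at_right_top)
  ultimately have "((\<lambda>t. V (1 / inverse t) / (inverse t * (inverse t powr (- \<gamma>) * Q (1 / inverse t)))) \<longlongrightarrow> rGamma \<gamma> / a) at_top"
    by (rule filterlim_compose)
  moreover have "\<forall>\<^sub>F t in at_top. V (1 / inverse t) / (inverse t * (inverse t powr (- \<gamma>) * Q (1 / inverse t)))
      = v t / (t powr (\<gamma> - 1) * Q t)"
    using eventually_gt_at_top[of 0]
  proof eventually_elim
    case (elim t)
    then have "inverse t * inverse t powr (- \<gamma>) = t powr (\<gamma> - 1)"
      by (simp add: powr_diff powr_minus inverse_powr divide_inverse mult.commute)
    then show ?case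
      using elim by (simp add: v_V mult.assoc[symmetric] divide_inverse)
  qed
  ultimately have lim: "((\<lambda>t. v t / (t powr (\<gamma> - 1) * Q t)) \<longlongrightarrow> rGamma \<gamma> / a) at_top"
    by (rule Lim_transform_eventually)
  have nz: "\<forall>\<^sub>F t in at_top. t powr (\<gamma> - 1) * Q t \<noteq> 0"
    using slowly_varying_eventually_nonzero[OF Q] eventually_gt_at_top[of 0] by eventually_elim simp
  have "v \<sim>[at_top] (\<lambda>t. 1 / (\<alpha> * norm w * Gamma \<gamma>) * t powr (\<gamma> - 1) * Q t)" if "0 < \<gamma>"
  proof (rule asymp_equivI')
    have "((\<lambda>t. (a * Gamma \<gamma>) * (v t / (t powr (\<gamma> - 1) * Q t))) \<longlongrightarrow> (a * Gamma \<gamma>) * (rGamma \<gamma> / a)) at_top"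
      by (intro tendsto_intros lim)
    also have "(a * Gamma \<gamma>) * (rGamma \<gamma> / a) = 1"
      using a Gamma_real_pos[OF that] by (simp add: rGamma_inverse_Gamma)
    also have "(\<lambda>t. (a * Gamma \<gamma>) * (v t / (t powr (\<gamma> - 1) * Q t)))
        = (\<lambda>t. v t / (1 / (\<alpha> * norm w * Gamma \<gamma>) * t powr (\<gamma> - 1) * Q t))"
      by (simp add: a_def fun_eq_iff)
    finally show "((\<lambda>t. v t / (1 / (\<alpha> * norm w * Gamma \<gamma>) * t powr (\<gamma> - 1) * Q t)) \<longlongrightarrow> 1) at_top" .
  qed
  \<comment> \<open>Here \<open>rGamma 0 = 0\<close>, so the same limit says that the quotient
    vanishes.\<close>
  moreover have "v \<in> o[at_top](\<lambda>t. t powr (\<gamma> - 1) * Q t)" if "\<gamma> = 0"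
    using lim nz that by (intro smalloI_tendsto) simp_all
  ultimately show ?thesis
    using u_eq v_density by blast
qed

end
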